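(* $\mathcal{GM}(\Delta^3)\simeq\mathcal{GM}(\partial\Delta^3)\simeq\bigvee^{39}S^4$.
   Context: All simplicial complexes are finite abstract simplicial complexes; simplices are nonempty. $\Delta^3$ is the simplicial complex of all nonempty subsets of a $4$-element vertex set and $\partial\Delta^3$ its subcomplex of proper nonempty subsets. The Hasse diagram $\mathcal{H}(K)$ of $K$ is the directed graph whose vertices are the simplices of $K$, with an edge $\sigma\to\tau$ whenever $\sigma\subsetneq\tau$ and $\dim\tau=\dim\sigma+1$. A matching on $\mathcal{H}(K)$ is a set of edges of $\mathcal{H}(K)$, no two sharing a vertex. The generalized complex of discrete Morse matchings $\mathcal{GM}(K)$ is the simplicial complex whose vertices are the edges of $\mathcal{H}(K)$ and whose simplices are all nonempty matchings on $\mathcal{H}(K)$ (no acyclicity condition). *)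

theory Defs
  imports "HOL-Analysis.Analysis"
begin

text \<open>Finite abstract simplicial complexes are represented as sets of nonempty
finite vertex sets (closed under nonempty subsets).\<close>

definition simplex3 :: "nat set set" where
  "simplex3 = {\<sigma>. \<sigma> \<subseteq> {0..3} \<and> \<sigma> \<noteq> {}}"

definition boundary_simplex3 :: "nat set set" where
  "boundary_simplex3 = {\<sigma>. \<sigma> \<subseteq> {0..3} \<and> \<sigma> \<noteq> {} \<and> \<sigma> \<noteq> {0..3}}"

definition hasse_edges :: "'a set set \<Rightarrow> ('a set \<times> 'a set) set" where
  "hasse_edges K = {(\<sigma>, \<tau>). \<sigma> \<in> K \<and> \<tau> \<in> K \<and> \<sigma> \<subset> \<tau> \<and> card \<tau> = card \<sigma> + 1}"

definition is_matching :: "('a set \<times> 'a set) set \<Rightarrow> bool" where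
  "is_matching M \<longleftrightarrow> (\<forall>e\<in>M. \<forall>e'\<in>M. e \<noteq> e' \<longrightarrow>
       {fst e, snd e} \<inter> {fst e', snd e'} = {})"

definition GM :: "'a set set \<Rightarrow> ('a set \<times> 'a set) set set" where
  "GM K = {M. M \<noteq> {} \<and> M \<subseteq> hasse_edges K \<and> is_matching M}"

text \<open>Geometric realization of a finite simplicial complex K: functions
(barycentric coordinates) that are nonnegative, sum to 1, and whose support is a
simplex of K; topology inherited from the product topology (for a finite complex
this is the usual Euclidean topology of the realization).\<close>
definition geometric_realization :: "'a set set \<Rightarrow> ('a \<Rightarrow> real) topology" where
  "geometric_realization K = subtopology (powertop_real UNIV)
     {f. (\<forall>v. 0 \<le> f v) \<and> {v. f v \<noteq> 0} \<in> K \<and> finite {v. f v \<noteq> 0}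
         \<and> sum f {v. f v \<noteq> 0} = 1}"

text \<open>Wedge of k copies of the m-sphere, realized concretely: the j-th sphere
(j < k) lives in coordinates (j,0..m), is centered at e_(j,0) with radius 1,
so all spheres pass through the origin and pairwise meet only there.\<close>
definition wedge_of_spheres :: "nat \<Rightarrow> nat \<Rightarrow> (nat \<times> nat \<Rightarrow> real) topology" where
  "wedge_of_spheres k m = subtopology (powertop_real UNIV)
     (\<Union>j<k. {x. (\<Sum>i\<le>m. (x (j, i) - (if i = 0 then 1 else 0))^2) = 1 \<and>
                 (\<forall>j' i. (j' \<noteq> j \<or> i > m) \<longrightarrow> x (j', i) = 0)})"

end

(* Both complexes are independence complexes: the vertices are the edges of the Hasse diagram, and
   two of them are adjacent when they share a node. Splitting the independent sets according to
   whether they contain a vertex v (or a pair u, v), until every remaining part is either a single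
   cell or is paired off by a vertex w that is adjacent to nothing left, gives an acyclic matching.
   For both complexes there is such a decision tree with exactly 39 critical cells, all of
   dimension 4, besides the vertex paired with the empty set.

   Order the matched pairs as in the tree. The pairs (C, C + w) with dim C < 4 alone build a
   subcomplex L, which is an absolute retract because each step glues on a simplex along a cone.
   L contains the boundaries of the critical cells, and the remaining pairs only deform the complex.
   Contracting L by homotopy extension turns L with the 39 cells into a wedge of 39 4-spheres. *)

theory Submission
  imports Defs
begin

text \<open>Discrete Morse theory usually ends with a CW complex whose attaching maps are known only
  up to homotopy. Here they never appear. All critical cells have five vertices, so every cell with
  at most four vertices belongs to a pair whose smaller member has at most four vertices. The facets
  that such a pair needs are again of that size, so these pairs can be listed without the rest, and
  afterwards all critical cells can be glued on at once. The wedge is then an honest quotient of a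
  polyhedron by a contractible subcomplex, given by one explicit formula on every critical simplex.

  The number 39 is forced: when every critical cell has dimension 4, their number equals the reduced
  Euler characteristic, so all trees with leaves of the right size have the same count. That the
  tetrahedron and its boundary agree is an equality of two such numbers.

  Acyclicity comes from the shape of the tree: a cell without \<open>v\<close> has no face
  containing \<open>v\<close>, so the part without \<open>v\<close> can always be listed before the
  part with \<open>v\<close>.\<close>

section \<open>Homotopy equivalences from convex pieces and from quotients\<close>

text \<open>An absolute retract that is closed in \<open>C\<close> is a retract of \<open>C\<close>.
  Extended by the identity on \<open>X\<close>, the retraction is homotopic to the identity along
  segments: these stay in the convex set \<open>C\<close> and are constant on
  \<open>X\<close>.\<close>

lemma homotopy_equivalent_Un_convex:
  fixes X C :: "'a::euclidean_space set"
  assumes X: "closed X" and C: "closed C" "convex C" and AR: "AR (X \<inter> C)"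
  shows "top_of_set (X \<union> C) homotopy_equivalent_space top_of_set X"
proof -
  have "(X \<inter> C) retract_of C"
    using AR X C by (intro AR_imp_retract) (auto simp: closedin_closed)
  then obtain r where r: "retraction C (X \<inter> C) r"
    by (auto simp: retract_of_def)
  then have contr: "continuous_on C r" and rim: "r ` C \<subseteq> X \<inter> C" and rid: "\<And>x. x \<in> X \<inter> C \<Longrightarrow> r x = x"
    by (auto simp: retraction_def)
  define \<rho> where "\<rho> = (\<lambda>x. if x \<in> X then x else r x)"
  have rC: "\<rho> x = r x" if "x \<in> C" for x
    using that rid by (auto simp: \<rho>_def)
  have cont: "continuous_on (X \<union> C) \<rho>"
    unfolding \<rho>_def using X C contr rid
    by (intro continuous_on_cases) (auto intro: continuous_intros)
  have im: "\<rho> ` (X \<union> C) \<subseteq> X"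
    using rim by (auto simp: \<rho>_def)
  have "homotopic_with_canon (\<lambda>x. True) (X \<union> C) (X \<union> C) \<rho> id"
  proof (rule homotopic_with_linear)
    show "closed_segment (\<rho> x) (id x) \<subseteq> X \<union> C" if "x \<in> X \<union> C" for x
    proof (cases "x \<in> C")
      case True
      then have "closed_segment (\<rho> x) (id x) \<subseteq> C"
        using rim C(2) rC by (intro closed_segment_subset) auto
      then show ?thesis by blast
    qed (use that in \<open>auto simp: \<rho>_def\<close>)
  qed (use cont in \<open>auto intro: continuous_intros\<close>)
  then have "homotopic_with_canon (\<lambda>x. True) (X \<union> C) (X \<union> C) id \<rho>"
    by (rule homotopic_with_symD)
  moreover have "retraction (X \<union> C) X \<rho>"
    using cont im by (simp add: retraction_def image_subset_iff_funcset) (simp add: \<rho>_def)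
  ultimately show ?thesis
    by (rule deformation_retract_imp_homotopy_eqv)
qed

section \<open>Homotopy extension and collapsing a contractible subset\<close>

text \<open>Borsuk's extension theorem is applied to the cylinder over \<open>X\<close> and its
  closed part \<open>B\<close>, the bottom together with the cylinder over \<open>L\<close>.
  Extending a map over the whole cylinder, not just an end map over \<open>X\<close>, makes the
  result agree with the given contraction of \<open>L\<close> at every time.\<close>

lemma contraction_extension:
  fixes X L :: "'a::euclidean_space set"
  assumes X: "ANR X" and L: "closedin (top_of_set X) L" "contractible L"
  obtains H :: "real \<times> 'a \<Rightarrow> 'a" and c where "continuous_on ({0..1} \<times> X) H"
    "H ` ({0..1} \<times> X) \<subseteq> X" "\<And>x. x \<in> X \<Longrightarrow> H (0, x) = x"
    "\<And>t x. t \<in> {0..1} \<Longrightarrow> x \<in> L \<Longrightarrow> H (t, x) \<in> L" "\<And>x. x \<in> L \<Longrightarrow> H (1, x) = c"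
proof -
  have LX: "L \<subseteq> X" using L(1) closedin_imp_subset by blast
  obtain c where "homotopic_with_canon (\<lambda>x. True) L L id (\<lambda>x. c)"
    using L(2) by (auto simp: contractible_def id_def)
  then obtain h where conth: "continuous_on ({0..1} \<times> L) h" and him: "h \<in> ({0..1} \<times> L) \<rightarrow> L"
    and h0: "\<And>x. h (0::real, x) = x" and h1: "\<And>x. h (1::real, x) = c"
    by (fastforce simp: homotopic_with_def)
  define T where "T = {0..1::real} \<times> X"
  define B where "B = {0::real} \<times> X \<union> {0..1} \<times> L"
  define k where "k = (\<lambda>(s::real, t::real, x). if x \<in> L then h (s * t, x) else x)"
  have BT: "closedin (top_of_set T) B"
    unfolding B_def T_def
    by (intro closedin_Un closedin_Times) (auto simp: L)
  have cl1: "closedin (top_of_set ({0..1::real} \<times> B)) ({0..1} \<times> ({0} \<times> X))"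
  proof -
    have "{0..1::real} \<times> ({0::real} \<times> X) = ({0..1} \<times> B) \<inter> (UNIV \<times> ({0} \<times> UNIV))"
      using LX by (auto simp: B_def)
    moreover have "closedin (top_of_set ({0..1::real} \<times> B)) (({0..1} \<times> B) \<inter> (UNIV \<times> ({0::real} \<times> UNIV)))"
      by (intro closedin_closed_Int closed_Times closed_UNIV closed_singleton)
    ultimately show ?thesis by simp
  qed
  obtain D where D: "closed D" "L = X \<inter> D" using L(1) by (auto simp: closedin_closed)
  have cl2: "closedin (top_of_set ({0..1::real} \<times> B)) ({0..1} \<times> ({0..1} \<times> L))"
  proof -
    have "{0..1::real} \<times> ({0..1::real} \<times> L) = ({0..1} \<times> B) \<inter> (UNIV \<times> (UNIV \<times> D))"
      using D by (auto simp: B_def)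
    then show ?thesis using D by (auto simp: closedin_closed intro!: exI[of _ "UNIV \<times> (UNIV \<times> D)"] closed_Times)
  qed
  have e: "{0..1::real} \<times> B = ({0..1} \<times> ({0..1} \<times> L)) \<union> ({0..1} \<times> ({0} \<times> X))"
    by (auto simp: B_def)
  have contk: "continuous_on ({0..1} \<times> B) k"
  proof -
    have "continuous_on ({0..1} \<times> B) (\<lambda>z. if snd (snd z) \<in> L then h (fst z * fst (snd z), snd (snd z)) else snd (snd z))"
      unfolding e
    proof (rule continuous_on_cases_local)
      show "continuous_on ({0..1} \<times> ({0..1} \<times> L)) (\<lambda>z. h (fst z * fst (snd z), snd (snd z)))"
      proof (rule continuous_on_compose2[OF conth])
        show "(\<lambda>z. (fst z * fst (snd z), snd (snd z))) ` ({0..1::real} \<times> {0..1::real} \<times> L) \<subseteq> {0..1} \<times> L"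
          by (auto intro: mult_le_one)
      qed (intro continuous_intros)
    qed (use cl1 cl2 h0 in \<open>auto intro!: continuous_intros simp: e\<close>)
    then show ?thesis by (simp add: k_def case_prod_unfold)
  qed
  have hX: "h (s * t, x) \<in> X" if "s \<in> {0..1}" "t \<in> {0..1}" "x \<in> L" for s t x
    using him that LX by (auto simp: mult_le_one Pi_iff)
  have "homotopic_with_canon (\<lambda>x. True) B X snd (\<lambda>z. k (1, z))"
    unfolding homotopic_with_def
  proof (intro exI conjI)
    show "continuous_map (prod_topology (top_of_set {0..1}) (top_of_set B)) (top_of_set X) k"
      using contk hX h0 by (auto simp: k_def B_def)
  qed (auto simp: k_def h0)
  moreover have "continuous_on T snd" "snd \<in> T \<rightarrow> X"
    by (auto simp: T_def intro: continuous_intros)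
  ultimately obtain g where g: "continuous_on T g" "image g T \<subseteq> X" "\<And>z. z \<in> B \<Longrightarrow> g z = k (1, z)"
    using Borsuk_homotopy_extension_homotopic[OF BT, of X snd "\<lambda>z. k (1, z)"] X by metis
  show ?thesis
  proof
    show "continuous_on ({0..1} \<times> X) g" "g ` ({0..1} \<times> X) \<subseteq> X"
      using g by (auto simp: T_def)
    show "g (0, x) = x" if "x \<in> X" for x using that g(3)[of "(0,x)"] by (auto simp: B_def k_def h0)
    show "g (t, x) \<in> L" if "t \<in> {0..1}" "x \<in> L" for t x
      using that g(3)[of "(t,x)"] him by (auto simp: B_def k_def Pi_iff)
    show "g (1, x) = c" if "x \<in> L" for x using that g(3)[of "(1,x)"] by (auto simp: B_def k_def h1)
  qed
qed

text \<open>\<open>W\<close> is \<open>X\<close> with \<open>L\<close> collapsed to a point. The end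
  of the homotopy \<open>H\<close> is constant on \<open>L\<close>, so it factors through
  \<open>q\<close> as some \<open>g\<close>, a homotopy inverse of \<open>q\<close>. Since
  \<open>H\<close> keeps \<open>L\<close> inside \<open>L\<close>, it also descends to a homotopy of
  \<open>W\<close> from the identity to \<open>q \<circ> g\<close>.\<close>

lemma homotopy_equivalent_quotient:
  fixes X L :: "'a::euclidean_space set"
  assumes X: "compact X" "ANR X" and L: "closedin (top_of_set X) L" "contractible L"
    and W: "Hausdorff_space W" and q: "continuous_map (top_of_set X) W q" "q ` X = topspace W"
    and collapse: "\<And>x y. x \<in> L \<Longrightarrow> y \<in> L \<Longrightarrow> q x = q y"
    and fibre: "\<And>x y. x \<in> X \<Longrightarrow> y \<in> X \<Longrightarrow> q x = q y \<Longrightarrow> x = y \<or> x \<in> L \<and> y \<in> L"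
  shows "top_of_set X homotopy_equivalent_space W"
proof -
  obtain H :: "real \<times> 'a \<Rightarrow> 'a" and c where H: "continuous_on ({0..1} \<times> X) H"
    "H ` ({0..1} \<times> X) \<subseteq> X" "\<And>x. x \<in> X \<Longrightarrow> H (0, x) = x"
    "\<And>t x. t \<in> {0..1} \<Longrightarrow> x \<in> L \<Longrightarrow> H (t, x) \<in> L" "\<And>x. x \<in> L \<Longrightarrow> H (1, x) = c"
    using contraction_extension[OF X(2) L] by metis
  let ?I = "top_of_set {0..1::real}" and ?X = "top_of_set X"
  have contH: "continuous_map (prod_topology ?I ?X) ?X H"
    using H by auto
  have quo: "quotient_map ?X W q"
    using X q W by (intro continuous_imp_quotient_map) (auto simp: compact_space_subtopology)
  have contH1: "continuous_map ?X ?X (\<lambda>x. H (1, x))"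
    using H(1,2) by (auto intro!: continuous_on_compose2[OF H(1)] continuous_intros)
  obtain g where g: "continuous_map W ?X g" "\<And>x. x \<in> X \<Longrightarrow> g (q x) = H (1, x)"
  proof (rule quotient_map_lift_exists[OF quo contH1])
    fix x y assume "x \<in> topspace ?X" "y \<in> topspace ?X" "q x = q y"
    then show "H (1, x) = H (1, y)" using fibre[of x y] H(5) by auto
  qed auto
  define Q where "Q = (\<lambda>(t::real, x). (t, q x))"
  have contQ: "continuous_map (prod_topology ?I ?X) (prod_topology ?I W) Q"
    unfolding Q_def case_prod_unfold
    by (intro continuous_map_pairedI continuous_map_fst continuous_map_compose[OF continuous_map_snd q(1), unfolded o_def])
  \<comment> \<open>The product of a quotient map with an interval is again a quotient map here
    because it is a continuous surjection from a compact space onto a Hausdorff space.\<close>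
  have quoQ: "quotient_map (prod_topology ?I ?X) (prod_topology ?I W) Q"
  proof (rule continuous_imp_quotient_map[OF contQ])
    show "compact_space (prod_topology ?I ?X)"
      using X by (simp only: compact_space_prod_topology) (simp add: compact_space_subtopology)
    show "Hausdorff_space (prod_topology ?I W)"
      using W by (simp add: Hausdorff_space_prod_topology Hausdorff_space_subtopology)
    show "Q ` topspace (prod_topology ?I ?X) = topspace (prod_topology ?I W)"
      using q(2) by (force simp: Q_def image_iff)
  qed
  have contqH: "continuous_map (prod_topology ?I ?X) W (q \<circ> H)"
    using contH q(1) by (rule continuous_map_compose)
  obtain G where G: "continuous_map (prod_topology ?I W) W G"
    "\<And>z. z \<in> {0..1} \<times> X \<Longrightarrow> G (Q z) = q (H z)"
  proof (rule quotient_map_lift_exists[OF quoQ contqH])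
    fix z z' assume "z \<in> topspace (prod_topology ?I ?X)" "z' \<in> topspace (prod_topology ?I ?X)" "Q z = Q z'"
    then obtain t x y where z: "z = (t, x)" "z' = (t, y)" "t \<in> {0..1}" "x \<in> X" "y \<in> X" "q x = q y"
      by (auto simp: Q_def)
    then show "(q \<circ> H) z = (q \<circ> H) z'"
      using fibre[of x y] collapse[OF H(4) H(4), of t x t y] by auto
  qed auto
  have "homotopic_with (\<lambda>x. True) ?X ?X id (\<lambda>x. H (1, x))"
    using contH H(3) by (subst homotopic_with) (auto intro!: exI[of _ H])
  then have "homotopic_with (\<lambda>x. True) ?X ?X id (g \<circ> q)"
    by (rule homotopic_with_eq) (auto simp: g)
  moreover have "homotopic_with (\<lambda>x. True) W W id (q \<circ> g)"
    proof (subst homotopic_with, simp, intro exI[of _ G] conjI ballI)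
    fix w assume "w \<in> topspace W"
    then obtain x where x: "x \<in> X" "w = q x" using q(2) by auto
    show "G (0, w) = id w" using G(2)[of "(0,x)"] x H(3) by (auto simp: Q_def)
    show "G (1, w) = (q \<circ> g) w" using G(2)[of "(1,x)"] x g by (auto simp: Q_def)
  qed (use G in auto)
  ultimately have "homotopic_with (\<lambda>x. True) ?X ?X (g \<circ> q) id" "homotopic_with (\<lambda>x. True) W W (q \<circ> g) id"
    by (auto intro: homotopic_with_symD)
  then show ?thesis
    unfolding homotopy_equivalent_space_def using g(1) q(1) by (intro exI conjI)
qed

section \<open>Collapsing the boundary of a simplex onto a sphere\<close>

text \<open>On barycentric coordinates with P = min b > 0, the vector (b i - b 0) / P ranges over all of
  R^m, bijectively; the map below is inverse stereographic projection of this vector, from the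
  origin onto the sphere of radius 1 around the 0-th basis vector, with denominators cleared so that
  it extends continuously by 0 to the boundary P = 0.\<close>

definition min_coord :: "nat \<Rightarrow> (nat \<Rightarrow> real) \<Rightarrow> real" where
  "min_coord m b = Min (b ` {..m})"

definition sphere_denom :: "nat \<Rightarrow> (nat \<Rightarrow> real) \<Rightarrow> real" where
  "sphere_denom m b = (min_coord m b)\<^sup>2 + (\<Sum>i\<in>{1..m}. (b i - b 0)\<^sup>2)"

definition simplex_to_sphere :: "nat \<Rightarrow> (nat \<Rightarrow> real) \<Rightarrow> nat \<Rightarrow> real" where
  "simplex_to_sphere m b i =
     2 * min_coord m b * (if i = 0 then min_coord m b else b i - b 0) / sphere_denom m b"

lemma min_coord_le: "i \<le> m \<Longrightarrow> min_coord m b \<le> b i"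
  by (auto simp: min_coord_def)

lemma min_coord_attained: "\<exists>i\<le>m. min_coord m b = b i"
proof -
  have "Min (b ` {..m}) \<in> b ` {..m}" by (rule Min_in) auto
  then show ?thesis unfolding min_coord_def by blast
qed

text \<open>A zero denominator would make all coordinates equal with minimum 0, hence all zero,
  against their sum being 1. This holds on the boundary of the simplex too, which is why the map is
  continuous there.\<close>

lemma sphere_denom_pos:
  assumes "sum b {..m} = 1"
  shows "sphere_denom m b > 0"
proof (rule ccontr)
  assume "\<not> sphere_denom m b > 0"
  moreover have "0 \<le> (\<Sum>i\<in>{1..m}. (b i - b 0)\<^sup>2)" by (intro sum_nonneg) auto
  ultimately have P: "min_coord m b = 0" and "(\<Sum>i\<in>{1..m}. (b i - b 0)\<^sup>2) = 0"
    unfolding sphere_denom_def by (smt (verit) zero_le_power2 zero_eq_power2)+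
  then have "\<forall>i\<in>{1..m}. b i = b 0" by (simp add: sum_nonneg_eq_0_iff)
  then have eq: "b i = b 0" if "i \<le> m" for i using that by (cases "i = 0") auto
  then have "\<forall>i\<le>m. b i = 0" using min_coord_attained[of m b] P by metis
  then show False using assms by simp
qed

lemma sum_atMost_split0: "sum f {..m::nat} = f 0 + (sum f {1..m} :: real)"
  by (simp add: sum.atLeast_Suc_atMost atMost_atLeast0)

lemma simplex_to_sphere_on_sphere:
  assumes "sum b {..m} = 1"
  shows "(\<Sum>i\<le>m. (simplex_to_sphere m b i - (if i = 0 then 1 else 0))\<^sup>2) = 1"
proof -
  define P D where "P = min_coord m b" and "D = sphere_denom m b"
  have D: "D > 0" using sphere_denom_pos[OF assms] by (simp add: D_def)
  have DP: "(\<Sum>i\<in>{1..m}. (b i - b 0)\<^sup>2) = D - P\<^sup>2" by (simp add: D_def P_def sphere_denom_def)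
  have "(\<Sum>i\<le>m. (simplex_to_sphere m b i - (if i = 0 then 1 else 0))\<^sup>2) =
      (2 * P * P / D - 1)\<^sup>2 + (\<Sum>i\<in>{1..m}. (2 * P / D)\<^sup>2 * (b i - b 0)\<^sup>2)"
    unfolding sum_atMost_split0
    by (intro arg_cong2[where f="(+)"] sum.cong) 
       (auto simp: simplex_to_sphere_def P_def D_def power_mult_distrib power_divide)
  also have "\<dots> = (2 * P * P / D - 1)\<^sup>2 + (2 * P / D)\<^sup>2 * (D - P\<^sup>2)"
    by (simp only: sum_distrib_left[symmetric] DP)
  also have "\<dots> = 1" using D by (simp add: field_simps power2_eq_square)
  finally show ?thesis .
qed

text \<open>Dividing coordinate \<open>i\<close> of the image by coordinate 0 recovers
  \<open>(b i - b 0) / P\<close>. Hence \<open>b / P\<close> and \<open>c / Q\<close> differ by a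
  constant \<open>k\<close>; both have minimum 1, so \<open>k = 0\<close>. The points are then
  proportional, and both have sum 1.\<close>

lemma simplex_to_sphere_inj:
  assumes b: "sum b {..m} = 1" "min_coord m b > 0" and c: "sum c {..m} = 1" "min_coord m c > 0"
    and eq: "\<And>i. i \<le> m \<Longrightarrow> simplex_to_sphere m b i = simplex_to_sphere m c i"
    and i: "i \<le> m"
  shows "b i = c i"
proof -
  define P Q where "P = min_coord m b" and "Q = min_coord m c"
  have PQ: "P > 0" "Q > 0" using b c by (auto simp: P_def Q_def)
  have D: "sphere_denom m b > 0" "sphere_denom m c > 0" using sphere_denom_pos b c by auto
  have e0: "P * P / sphere_denom m b = Q * Q / sphere_denom m c"
    using eq[of 0] by (simp add: simplex_to_sphere_def P_def Q_def)
  have ratio: "(b i - b 0) / P = (c i - c 0) / Q" if "i \<le> m" for i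
  proof (cases "i = 0")
    case False
    have "P * (b i - b 0) / sphere_denom m b = Q * (c i - c 0) / sphere_denom m c"
      using eq[OF that] False by (simp add: simplex_to_sphere_def P_def Q_def)
    then have "(P * (b i - b 0) / sphere_denom m b) / (P * P / sphere_denom m b) =
       (Q * (c i - c 0) / sphere_denom m c) / (Q * Q / sphere_denom m c)" using e0 by simp
    moreover have "(P * (b i - b 0) / sphere_denom m b) / (P * P / sphere_denom m b) = (b i - b 0) / P"
      "(Q * (c i - c 0) / sphere_denom m c) / (Q * Q / sphere_denom m c) = (c i - c 0) / Q"
      using PQ D by (simp_all add: divide_simps)
    ultimately show ?thesis by simp
  qed simp
  define k where "k = b 0 / P - c 0 / Q"
  have sh: "b i / P = c i / Q + k" if "i \<le> m" for i
    using ratio[OF that] by (simp add: k_def diff_divide_distrib)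
  obtain i1 where i1: "i1 \<le> m" "b i1 = P" using min_coord_attained[of m b] P_def by metis
  obtain i2 where i2: "i2 \<le> m" "c i2 = Q" using min_coord_attained[of m c] Q_def by metis
  have "1 \<le> c i1 / Q" using min_coord_le[OF i1(1), of c] PQ by (simp add: Q_def)
  moreover have "1 \<le> b i2 / P" using min_coord_le[OF i2(1), of b] PQ by (simp add: P_def)
  moreover have "c i1 / Q + k = 1" "b i2 / P = 1 + k"
    using sh[OF i1(1)] sh[OF i2(1)] i1 i2 PQ by simp_all
  ultimately have "k = 0" by linarith
  then have r: "b i = c i * (P / Q)" if "i \<le> m" for i using sh[OF that] PQ by (simp add: field_simps)
  have "sum b {..m} = sum c {..m} * (P / Q)"
    unfolding sum_distrib_right by (intro sum.cong) (auto simp: r)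
  then show ?thesis using b c r[OF i] PQ by simp
qed

text \<open>The ratios \<open>y i / y 0\<close> are the stereographic coordinates of
  \<open>y\<close>. Shifting them to have minimum 1 and dividing by their sum \<open>s\<close> gives
  a preimage, with least coordinate \<open>1 / s\<close>. The condition on \<open>y 0\<close>
  excludes only the origin, the image of the boundary.\<close>

lemma simplex_to_sphere_surj:
  assumes y: "(\<Sum>i\<le>m. (y i - (if i = 0 then 1 else 0))\<^sup>2) = 1" and y0: "y 0 \<noteq> 0"
  obtains b where "sum b {..m} = 1" "\<And>i. i \<le> m \<Longrightarrow> 0 < b i"
    "\<And>i. i \<le> m \<Longrightarrow> simplex_to_sphere m b i = y i"
proof -
  have "(y 0 - 1)\<^sup>2 + (\<Sum>i\<in>{1..m}. (y i)\<^sup>2) = 1"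
    using y by (simp add: sum_atMost_split0)
  then have ysum: "(\<Sum>i\<in>{1..m}. (y i)\<^sup>2) = 2 * y 0 - (y 0)\<^sup>2"
    by (simp add: power2_eq_square algebra_simps)
  define \<phi> where "\<phi> = (\<lambda>i. if i = 0 then 0 else y i / y 0)"
  define \<mu> where "\<mu> = min_coord m \<phi>"
  define s where "s = (\<Sum>i\<le>m. 1 + \<phi> i - \<mu>)"
  have pos: "1 + \<phi> i - \<mu> \<ge> 1" if "i \<le> m" for i using min_coord_le[OF that, of \<phi>] by (simp add: \<mu>_def)
  have s: "s > 0" unfolding s_def using pos by (intro sum_pos) force+
  define b where "b = (\<lambda>i. (1 + \<phi> i - \<mu>) / s)"
  have bsum: "sum b {..m} = 1" using s by (simp add: b_def sum_divide_distrib[symmetric] s_def[symmetric])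
  have Pb: "min_coord m b = 1 / s"
  proof (rule antisym)
    obtain i where i: "i \<le> m" "\<mu> = \<phi> i" using min_coord_attained[of m \<phi>] \<mu>_def by metis
    then show "min_coord m b \<le> 1 / s" using min_coord_le[OF i(1), of b] by (simp add: b_def)
    obtain j where "j \<le> m" "min_coord m b = b j" using min_coord_attained[of m b] by auto
    then show "1 / s \<le> min_coord m b" using pos[of j] s by (simp add: b_def divide_right_mono)
  qed
  have d: "b i - b 0 = \<phi> i / s" for i by (simp add: b_def \<phi>_def diff_divide_distrib[symmetric])
  have dsum: "(\<Sum>i\<in>{1..m}. (b i - b 0)\<^sup>2) = (\<Sum>i\<in>{1..m}. (y i)\<^sup>2) / (s * y 0)\<^sup>2"
    unfolding d sum_divide_distrib
    by (intro sum.cong) (auto simp: \<phi>_def power_divide power_mult_distrib mult.commute)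
  have "sphere_denom m b = (1 / s)\<^sup>2 + (2 * y 0 - (y 0)\<^sup>2) / (s * y 0)\<^sup>2"
    by (simp only: sphere_denom_def Pb dsum ysum)
  then have D: "sphere_denom m b = 2 / (s\<^sup>2 * y 0)"
    using s y0 by (simp add: field_simps power2_eq_square)
  show ?thesis
  proof
    show "0 < b i" if "i \<le> m" for i using pos[OF that] s by (simp add: b_def)
    show "simplex_to_sphere m b i = y i" if "i \<le> m" for i
      using s y0 by (auto simp: simplex_to_sphere_def Pb D d \<phi>_def field_simps power2_eq_square)
  qed (rule bsum)
qed

lemma continuous_on_Min_image:
  fixes f :: "'i \<Rightarrow> 'a::topological_space \<Rightarrow> real"
  assumes "finite I" "I \<noteq> {}" "\<And>i. i \<in> I \<Longrightarrow> continuous_on S (f i)"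
  shows "continuous_on S (\<lambda>x. Min ((\<lambda>i. f i x) ` I))"
  using assms
proof (induction I rule: finite_ne_induct)
  case (insert i I)
  then have "continuous_on S (\<lambda>x. min (f i x) (Min ((\<lambda>i. f i x) ` I)))"
    by (intro continuous_on_min) auto
  then show ?case using insert by simp
qed simp

lemma continuous_on_simplex_to_sphere:
  assumes b: "\<And>i. i \<le> m \<Longrightarrow> continuous_on S (\<lambda>x. b x i)" and "\<And>x. x \<in> S \<Longrightarrow> sum (b x) {..m} = 1"
    and i: "i \<le> m"
  shows "continuous_on S (\<lambda>x. simplex_to_sphere m (b x) i)"
proof -
  have P: "continuous_on S (\<lambda>x. min_coord m (b x))"
    unfolding min_coord_def using b by (intro continuous_on_Min_image) auto
  have D: "continuous_on S (\<lambda>x. sphere_denom m (b x))"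
    unfolding sphere_denom_def using b by (intro continuous_intros P) auto
  have N: "continuous_on S (\<lambda>x. if i = 0 then min_coord m (b x) else b x i - b x 0)"
    using b i P by (cases "i = 0") (auto intro!: continuous_intros)
  have "\<forall>x\<in>S. sphere_denom m (b x) \<noteq> 0"
    using sphere_denom_pos assms(2) by (metis less_irrefl)
  then show ?thesis
    unfolding simplex_to_sphere_def
    by (intro continuous_on_divide continuous_on_mult continuous_on_const P N D)
qed

section \<open>Realizing complexes on basis vectors\<close>

text \<open>An empty cell contributes nothing, as the hull of the empty set is empty. Families of
  cells may therefore contain \<open>{}\<close> without changing the realization.\<close>

definition realize :: "('v \<Rightarrow> 'b::euclidean_space) \<Rightarrow> 'v set set \<Rightarrow> 'b set" where
  "realize p K = (\<Union>\<sigma>\<in>K. convex hull (p ` \<sigma>))"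

text \<open>The empty face is included, so every nonempty closed family contains \<open>{}\<close>.
  This lets the first vertex be treated as the partner of the empty set.\<close>

definition face_closed :: "'v set set \<Rightarrow> bool" where
  "face_closed K \<longleftrightarrow> (\<forall>\<sigma>\<in>K. \<forall>\<tau>. \<tau> \<subseteq> \<sigma> \<longrightarrow> \<tau> \<in> K)"

lemma face_closedD: "face_closed K \<Longrightarrow> \<sigma> \<in> K \<Longrightarrow> \<tau> \<subseteq> \<sigma> \<Longrightarrow> \<tau> \<in> K"
  by (auto simp: face_closed_def)

text \<open>With the vertices at distinct orthonormal basis vectors, barycentric coordinates are
  inner products and simplices meet exactly in their common faces.\<close>

locale basis_vertices =
  fixes V :: "'v set" and p :: "'v \<Rightarrow> 'b::euclidean_space"
  assumes finite_V: "finite V" and inj_p: "inj_on p V" and p_Basis: "p ` V \<subseteq> Basis"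
begin

lemma inner_p: "u \<in> V \<Longrightarrow> v \<in> V \<Longrightarrow> p u \<bullet> p v = (if u = v then 1 else 0)"
  using inj_p p_Basis by (auto simp: inner_Basis inj_on_def image_subset_iff)

text \<open>By orthonormality the weights of a convex combination can only be its inner products
  with the \<open>p v\<close>, so the existential over weights disappears.\<close>

lemma hull_iff:
  assumes \<sigma>: "\<sigma> \<subseteq> V"
  shows "x \<in> convex hull (p ` \<sigma>) \<longleftrightarrow>
    (\<forall>v\<in>\<sigma>. 0 \<le> x \<bullet> p v) \<and> (\<Sum>v\<in>\<sigma>. x \<bullet> p v) = 1 \<and> (\<Sum>v\<in>\<sigma>. (x \<bullet> p v) *\<^sub>R p v) = x"
proof -
  have fin: "finite \<sigma>" and inj: "inj_on p \<sigma>"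
    using \<sigma> finite_V inj_p by (auto intro: finite_subset inj_on_subset)
  have coord: "(\<Sum>v\<in>\<sigma>. u v *\<^sub>R p v) \<bullet> p w = u w" if "w \<in> \<sigma>" for u :: "'v \<Rightarrow> real" and w
  proof -
    have "(\<Sum>v\<in>\<sigma>. u v *\<^sub>R p v) \<bullet> p w = (\<Sum>v\<in>\<sigma>. if v = w then u v else 0)"
      unfolding inner_sum_left using that \<sigma> by (intro sum.cong) (auto simp: inner_p subset_iff)
    then show ?thesis using that fin by simp
  qed
  have "x \<in> convex hull (p ` \<sigma>) \<longleftrightarrow>
      (\<exists>u. (\<forall>v\<in>\<sigma>. 0 \<le> u v) \<and> sum u \<sigma> = 1 \<and> (\<Sum>v\<in>\<sigma>. u v *\<^sub>R p v) = x)"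
  proof
    assume "x \<in> convex hull (p ` \<sigma>)"
    then obtain u where "\<forall>y\<in>p ` \<sigma>. 0 \<le> u y" "sum u (p ` \<sigma>) = 1" "(\<Sum>y\<in>p ` \<sigma>. u y *\<^sub>R y) = x"
      using fin by (auto simp: convex_hull_finite)
    then show "\<exists>u. (\<forall>v\<in>\<sigma>. 0 \<le> u v) \<and> sum u \<sigma> = 1 \<and> (\<Sum>v\<in>\<sigma>. u v *\<^sub>R p v) = x"
      by (intro exI[of _ "u \<circ> p"]) (auto simp: sum.reindex[OF inj])
  next
    assume "\<exists>u. (\<forall>v\<in>\<sigma>. 0 \<le> u v) \<and> sum u \<sigma> = 1 \<and> (\<Sum>v\<in>\<sigma>. u v *\<^sub>R p v) = x"
    then show "x \<in> convex hull (p ` \<sigma>)"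
      using fin by (auto intro!: convex_sum simp: hull_inc)
  qed
  also have "\<dots> \<longleftrightarrow> (\<forall>v\<in>\<sigma>. 0 \<le> x \<bullet> p v) \<and> (\<Sum>v\<in>\<sigma>. x \<bullet> p v) = 1 \<and> (\<Sum>v\<in>\<sigma>. (x \<bullet> p v) *\<^sub>R p v) = x"
  proof safe
    fix u assume u: "\<forall>v\<in>\<sigma>. 0 \<le> u v" "sum u \<sigma> = 1" "x = (\<Sum>v\<in>\<sigma>. u v *\<^sub>R p v)"
    show "(\<Sum>v\<in>\<sigma>. u v *\<^sub>R p v) \<bullet> p v \<ge> 0" if "v \<in> \<sigma>" for v using u that by (simp add: coord)
    show "(\<Sum>v\<in>\<sigma>. (\<Sum>v\<in>\<sigma>. u v *\<^sub>R p v) \<bullet> p v) = 1" using u by (simp add: coord)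
    show "(\<Sum>v\<in>\<sigma>. ((\<Sum>v\<in>\<sigma>. u v *\<^sub>R p v) \<bullet> p v) *\<^sub>R p v) = (\<Sum>v\<in>\<sigma>. u v *\<^sub>R p v)"
      by (intro sum.cong) (auto simp: coord)
  qed (intro exI[of _ "\<lambda>v. x \<bullet> p v"], auto)
  finally show ?thesis .
qed

lemma hull_outside:
  assumes "\<sigma> \<subseteq> V" "x \<in> convex hull (p ` \<sigma>)" "v \<in> V - \<sigma>"
  shows "x \<bullet> p v = 0"
proof -
  have "x \<bullet> p v = (\<Sum>w\<in>\<sigma>. (x \<bullet> p w) *\<^sub>R p w) \<bullet> p v" using assms by (simp add: hull_iff)
  also have "\<dots> = (\<Sum>w\<in>\<sigma>. 0)"
    unfolding inner_sum_left using assms by (intro sum.cong) (auto simp: inner_p subset_iff)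
  finally show ?thesis by simp
qed

lemma hull_shrink:
  assumes "\<sigma> \<subseteq> V" "x \<in> convex hull (p ` \<sigma>)" "\<tau> \<subseteq> \<sigma>" "\<And>v. v \<in> \<sigma> - \<tau> \<Longrightarrow> x \<bullet> p v = 0"
  shows "x \<in> convex hull (p ` \<tau>)"
proof -
  have "finite \<sigma>" using assms finite_V finite_subset by blast
  then have "(\<Sum>v\<in>\<sigma>. x \<bullet> p v) = (\<Sum>v\<in>\<tau>. x \<bullet> p v)" "(\<Sum>v\<in>\<sigma>. (x \<bullet> p v) *\<^sub>R p v) = (\<Sum>v\<in>\<tau>. (x \<bullet> p v) *\<^sub>R p v)"
    using assms by (auto intro!: sum.mono_neutral_right)
  then show ?thesis using assms by (auto simp: hull_iff)
qed

lemma hull_Int: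
  assumes "\<sigma> \<subseteq> V" "\<tau> \<subseteq> V"
  shows "convex hull (p ` \<sigma>) \<inter> convex hull (p ` \<tau>) = convex hull (p ` (\<sigma> \<inter> \<tau>))"
proof
  show "convex hull (p ` \<sigma>) \<inter> convex hull (p ` \<tau>) \<subseteq> convex hull (p ` (\<sigma> \<inter> \<tau>))"
    using assms hull_outside[OF assms(2)] by (auto intro!: hull_shrink[of \<sigma>])
qed (auto intro: hull_mono[THEN subsetD, rotated] simp: image_mono)

lemma realize_Int_hull:
  assumes "face_closed K" "K \<subseteq> Pow V" "\<sigma> \<subseteq> V"
  shows "realize p K \<inter> convex hull (p ` \<sigma>) = realize p {\<tau> \<in> K. \<tau> \<subseteq> \<sigma>}"
proof
  show "realize p K \<inter> convex hull (p ` \<sigma>) \<subseteq> realize p {\<tau> \<in> K. \<tau> \<subseteq> \<sigma>}"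
  proof
    fix x assume "x \<in> realize p K \<inter> convex hull (p ` \<sigma>)"
    then obtain \<tau> where \<tau>: "\<tau> \<in> K" "x \<in> convex hull (p ` \<tau>)" "x \<in> convex hull (p ` \<sigma>)"
      by (auto simp: realize_def)
    then have "x \<in> convex hull (p ` (\<tau> \<inter> \<sigma>))" using assms hull_Int[of \<tau> \<sigma>] by blast
    moreover have "\<tau> \<inter> \<sigma> \<in> K" using assms(1) \<tau>(1) face_closedD by blast
    ultimately show "x \<in> realize p {\<tau> \<in> K. \<tau> \<subseteq> \<sigma>}" by (auto simp: realize_def)
  qed
qed (auto simp: realize_def intro: hull_mono[THEN subsetD, OF image_mono])

lemma compact_hull: "\<sigma> \<subseteq> V \<Longrightarrow> compact (convex hull (p ` \<sigma>))"
  by (intro compact_convex_hull finite_imp_compact finite_imageI) (rule finite_subset[OF _ finite_V])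

lemma compact_realize: "K \<subseteq> Pow V \<Longrightarrow> compact (realize p K)"
  unfolding realize_def using finite_V compact_hull
  by (intro compact_UN) (auto intro: finite_subset)

lemma ANR_realize: 
  assumes "K \<subseteq> Pow V" shows "ANR (realize p K)"
  unfolding realize_def using assms finite_V
  by (intro ANR_finite_Union_convex_closed) (auto intro: compact_imp_closed compact_hull finite_subset)

text \<open>The facets of a simplex through a fixed vertex form a cone.\<close>

lemma AR_free_face:
  assumes K: "face_closed K" "K \<subseteq> Pow V" and wC: "insert w C \<subseteq> V" "w \<notin> C" "C \<notin> K" "C \<noteq> {}"
    and facets: "\<And>x. x \<in> C \<Longrightarrow> insert w (C - {x}) \<in> K"
  shows "AR (realize p K \<inter> convex hull (p ` insert w C))"
proof -
  define F where "F = (\<lambda>x. insert w (C - {x})) ` C"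
  have F: "F \<subseteq> Pow V" "F \<noteq> {}" "\<And>\<sigma>. \<sigma> \<in> F \<Longrightarrow> w \<in> \<sigma>"
    using wC by (auto simp: F_def)
  have "realize p {\<tau> \<in> K. \<tau> \<subseteq> insert w C} = realize p F"
  proof
    show "realize p {\<tau> \<in> K. \<tau> \<subseteq> insert w C} \<subseteq> realize p F"
      unfolding realize_def
    proof safe
      fix \<tau> z assume \<tau>: "\<tau> \<in> K" "\<tau> \<subseteq> insert w C" "z \<in> convex hull (p ` \<tau>)"
      \<comment> \<open>A face of \<open>K\<close> inside \<open>insert w C\<close> cannot contain
        \<open>C\<close>, so it misses some \<open>x\<close> of \<open>C\<close> and lies in the
        facet opposite \<open>x\<close>, which contains \<open>w\<close>.\<close>
      have "\<not> C \<subseteq> \<tau>" using \<tau>(1) wC(3) K(1) face_closedD by blast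
      then obtain x where "x \<in> C" "x \<notin> \<tau>" by blast
      then have "\<tau> \<subseteq> insert w (C - {x})" using \<tau>(2) by blast
      then have "convex hull (p ` \<tau>) \<subseteq> convex hull (p ` insert w (C - {x}))"
        by (intro hull_mono image_mono)
      then have "z \<in> convex hull (p ` insert w (C - {x}))" using \<tau>(3) by (rule subsetD)
      then show "z \<in> (\<Union>\<sigma>\<in>F. convex hull (p ` \<sigma>))" using \<open>x \<in> C\<close> by (force simp: F_def)
    qed
    show "realize p F \<subseteq> realize p {\<tau> \<in> K. \<tau> \<subseteq> insert w C}"
      unfolding realize_def using facets by (intro UN_mono) (auto simp: F_def)
  qed
  then have eq: "realize p K \<inter> convex hull (p ` insert w C) = realize p F"
    using realize_Int_hull[OF K wC(1)] by (rule trans[rotated])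
  have "starlike (realize p F)"
    unfolding starlike_def
  proof (intro bexI ballI)
    show pw: "p w \<in> realize p F"
      using F by (force simp: realize_def intro: hull_inc)
    fix x assume "x \<in> realize p F"
    then obtain \<sigma> where "\<sigma> \<in> F" "x \<in> convex hull (p ` \<sigma>)" by (auto simp: realize_def)
    moreover from this have "p w \<in> convex hull (p ` \<sigma>)" using F by (auto intro: hull_inc)
    ultimately have "closed_segment (p w) x \<subseteq> convex hull (p ` \<sigma>)"
      by (simp add: closed_segment_subset)
    then show "closed_segment (p w) x \<subseteq> realize p F" using \<open>\<sigma> \<in> F\<close> by (auto simp: realize_def)
  qed
  moreover from this have "realize p F \<noteq> {}" by (auto simp: starlike_def)
  ultimately show ?thesis
    unfolding eq AR_ANR using F ANR_realize starlike_imp_contractible by blast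
qed

lemma realize_expansion:
  "realize p ({C, insert w C} \<union> K) = realize p K \<union> convex hull (p ` insert w C)"
  using hull_mono[of "p ` C" "p ` insert w C"] by (auto simp: realize_def)

text \<open>This is an elementary expansion, the inverse of a collapse: \<open>C\<close> is a free
  face of \<open>insert w C\<close>. The new simplex is convex and meets the old realization in a
  cone, so both gluing results for absolute retracts apply.\<close>

lemma
  assumes K: "face_closed K" "K \<subseteq> Pow V" and wC: "insert w C \<subseteq> V" "w \<notin> C" "C \<notin> K" "C \<noteq> {}"
    and facets: "\<And>x. x \<in> C \<Longrightarrow> insert w (C - {x}) \<in> K"
  shows AR_expansion: "AR (realize p K) \<Longrightarrow> AR (realize p ({C, insert w C} \<union> K))"
    and expansion_homotopy_equivalent: "top_of_set (realize p ({C, insert w C} \<union> K))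
      homotopy_equivalent_space top_of_set (realize p K)"
proof -
  have cl: "closed (realize p K)" "closed (convex hull (p ` insert w C))"
    using compact_realize[OF K(2)] compact_hull[OF wC(1)] by (auto intro: compact_imp_closed)
  have "AR (convex hull (p ` insert w C))" by (rule convex_imp_AR) auto
  then show "AR (realize p K) \<Longrightarrow> AR (realize p ({C, insert w C} \<union> K))"
    unfolding realize_expansion using cl AR_free_face[OF assms] by (intro AR_closed_Un) auto
  show "top_of_set (realize p ({C, insert w C} \<union> K))
      homotopy_equivalent_space top_of_set (realize p K)"
    unfolding realize_expansion using cl AR_free_face[OF assms] 
    by (intro homotopy_equivalent_Un_convex) auto
qed

end

section \<open>Equidimensional cells glued to a contractible complex\<close>

lemma continuous_map_into_powertop_subtopology:
  "continuous_map X (subtopology (powertop_real UNIV) S) f \<longleftrightarrow>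
    (\<forall>k. continuous_map X euclideanreal (\<lambda>x. f x k)) \<and> f \<in> topspace X \<rightarrow> S"
  by (auto simp: continuous_map_in_subtopology continuous_map_componentwise_UNIV)

context basis_vertices begin

text \<open>The quotient by the contractible subcomplex \<open>L\<close> is written down explicitly:
  the j-th cell is wrapped around the j-th sphere by \<open>simplex_to_sphere\<close>, and all of
  \<open>L\<close>, including the boundaries of the cells, goes to the origin.\<close>

lemma wedge_of_cells:
  assumes L: "face_closed L" "L \<subseteq> Pow V" "AR (realize p L)"
    and A: "A \<subseteq> Pow V" "card A = n" "n > 0" "\<And>C. C \<in> A \<Longrightarrow> card C = Suc m \<and> C \<notin> L"
    and facets: "\<And>C x. C \<in> A \<Longrightarrow> x \<in> C \<Longrightarrow> C - {x} \<in> L"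
  shows "top_of_set (realize p (L \<union> A)) homotopy_equivalent_space wedge_of_spheres n m"
proof -
  define X where "X = realize p (L \<union> A)"
  define Z where "Z = realize p L"
  have finA: "finite A" using A(2,3) card_gt_0_iff by metis
  obtain c where c: "bij_betw c {..<n} A"
    using ex_bij_betw_nat_finite[OF finA] A(2) atLeast0LessThan by metis
  have cA: "c j \<in> A" if "j < n" for j using c that by (auto simp: bij_betw_def)
  have cV: "c j \<subseteq> V" if "j < n" for j using cA[OF that] A(1) by auto
  have "\<exists>v. bij_betw v {..m} (c j)" if "j < n" for j
  proof -
    have "card (c j) = Suc m" using A(4) cA that by auto
    moreover from this have "finite (c j)" by (metis card.infinite nat.distinct(1))
    ultimately show ?thesis
      using ex_bij_betw_nat_finite[of "c j"] by (metis atLeast0LessThan lessThan_Suc_atMost)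
  qed
  then obtain v where v: "\<And>j. j < n \<Longrightarrow> bij_betw (v j) {..m} (c j)" by metis
  define b where "b = (\<lambda>j x i. x \<bullet> p (v j i))"
  define \<Delta> where "\<Delta> = (\<lambda>j. convex hull (p ` c j))"
  \<comment> \<open>The j-th block of coordinates sees only the j-th cell. The default 0 elsewhere
    agrees with the formula where that cell meets the rest, because the least coordinate vanishes
    there.\<close>
  define q where "q = (\<lambda>x (j, i). if j < n \<and> i \<le> m \<and> x \<in> \<Delta> j then simplex_to_sphere m (b j x) i else 0)"
  have X_eq: "X = Z \<union> (\<Union>j<n. \<Delta> j)"
    using c by (force simp: X_def Z_def \<Delta>_def realize_def bij_betw_def)
  have bsum: "sum (b j x) {..m} = 1" if "j < n" "x \<in> \<Delta> j" for j x
    using that hull_iff[OF cV, of j x] sum.reindex_bij_betw[OF v, of j "\<lambda>u. x \<bullet> p u"]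
    by (simp add: \<Delta>_def b_def)
  have bnonneg: "0 \<le> b j x i" if "j < n" "x \<in> \<Delta> j" "i \<le> m" for j x i
    using that hull_iff[OF cV, of j x] v[of j] by (auto simp: \<Delta>_def b_def bij_betw_def)
  have min_nonneg: "0 \<le> min_coord m (b j x)" if "j < n" "x \<in> \<Delta> j" for j x
    using min_coord_attained[of m "b j x"] bnonneg[OF that] by auto
  \<comment> \<open>The least coordinate detects the boundary. If it vanishes, the point lies in a
    facet, and facets are in \<open>L\<close>; conversely \<open>L\<close> meets the cell only in
    proper faces, since the cell itself is not in \<open>L\<close>.\<close>
  have min0: "min_coord m (b j x) = 0 \<longleftrightarrow> x \<in> Z" if j: "j < n" and x: "x \<in> \<Delta> j" for j x
  proof
    assume "min_coord m (b j x) = 0"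
    then obtain i where i: "i \<le> m" "x \<bullet> p (v j i) = 0"
      using min_coord_attained[of m "b j x"] by (auto simp: b_def)
    have "x \<in> convex hull (p ` (c j - {v j i}))"
    proof (rule hull_shrink[of "c j"])
      show "x \<bullet> p u = 0" if "u \<in> c j - (c j - {v j i})" for u using that i(2) by auto
    qed (use x cV[OF j] in \<open>auto simp: \<Delta>_def\<close>)
    moreover have "c j - {v j i} \<in> L"
      using facets[OF cA[OF j]] v[OF j] i by (auto simp: bij_betw_def)
    ultimately show "x \<in> Z" by (auto simp: Z_def realize_def)
  next
    assume "x \<in> Z"
    then have "x \<in> realize p {\<tau> \<in> L. \<tau> \<subseteq> c j}"
      using x realize_Int_hull[OF L(1,2) cV[OF j]] by (auto simp: Z_def \<Delta>_def)
    then obtain \<tau> where \<tau>: "\<tau> \<in> L" "\<tau> \<subseteq> c j" "x \<in> convex hull (p ` \<tau>)" by (auto simp: realize_def)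
    moreover have "c j \<notin> L" using A(4) cA[OF j] by auto
    ultimately obtain u where u: "u \<in> c j" "u \<notin> \<tau>" by (metis subsetI subset_antisym)
    then obtain i where i: "i \<le> m" "u = v j i" using v[OF j] by (auto simp: bij_betw_def)
    have "b j x i = 0"
      using hull_outside[of \<tau> x u] \<tau> u cV[OF j] i by (auto simp: b_def)
    then show "min_coord m (b j x) = 0"
      using min_coord_le[OF i(1), of "b j x"] min_nonneg[OF j x] by simp
  qed
  \<comment> \<open>Distinct cells of equal size meet in a proper face of each, so a common point
    has a vanishing coordinate.\<close>
  have meet: "x \<in> Z" if "j < n" "k < n" "j \<noteq> k" "x \<in> \<Delta> j" "x \<in> \<Delta> k" for j k x
  proof -
    have "c j \<noteq> c k" using c that by (auto simp: bij_betw_def inj_on_def)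
    moreover have "card (c j) = card (c k)" "finite (c k)" "finite (c j)"
      using A(4) cA that finite_subset[OF cV finite_V] by auto
    ultimately obtain u where u: "u \<in> c j" "u \<notin> c k" by (metis card_subset_eq subsetI)
    then obtain i where i: "i \<le> m" "u = v j i" using v[OF \<open>j < n\<close>] by (auto simp: bij_betw_def)
    have "b j x i = 0"
      using hull_outside[of "c k" x u] that u cV[of j] cV[of k] i by (auto simp: b_def \<Delta>_def)
    then have "min_coord m (b j x) = 0"
      using min_coord_le[OF i(1), of "b j x"] min_nonneg[of j x] that by simp
    then show ?thesis using min0 that by simp
  qed
  have q_Z: "q x k = 0" if "x \<in> Z" for x k
    using that min0[of "fst k" x] by (auto simp: q_def simplex_to_sphere_def split: prod.split)
  have q_0: "q x (j, 0) \<noteq> 0" if "j < n" "x \<in> \<Delta> j" "x \<notin> Z" for j x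
  proof -
    have "min_coord m (b j x) \<noteq> 0" using min0 that by auto
    moreover have "sphere_denom m (b j x) > 0" using sphere_denom_pos[OF bsum] that by simp
    ultimately show ?thesis using that by (simp add: q_def simplex_to_sphere_def)
  qed
  have q_other: "q x (k, i) = 0" if "j < n" "x \<in> \<Delta> j" "k \<noteq> j" for j k x i
  proof (cases "x \<in> Z")
    case False
    then show ?thesis using meet[of j k x] that by (auto simp: q_def)
  qed (rule q_Z)
  define S where "S = (\<lambda>j::nat. {y :: nat \<times> nat \<Rightarrow> real. (\<Sum>i\<le>m. (y (j, i) - (if i = 0 then 1 else 0))\<^sup>2) = 1 \<and>
                 (\<forall>j' i. (j' \<noteq> j \<or> i > m) \<longrightarrow> y (j', i) = 0)})"
  have W: "wedge_of_spheres n m = subtopology (powertop_real UNIV) (\<Union>j<n. S j)"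
    by (simp add: wedge_of_spheres_def S_def)
  have topW: "topspace (wedge_of_spheres n m) = (\<Union>j<n. S j)"
    by (simp add: W)
  have q_S: "q x \<in> S j" if "j < n" "x \<in> \<Delta> j" for j x
    using that simplex_to_sphere_on_sphere[OF bsum[OF that]] q_other[OF that]
    by (auto simp: S_def) (auto simp: q_def)
  have zero_S: "(\<lambda>_. 0) \<in> S j" for j
    by (auto simp: S_def sum_atMost_split0)
  have q_in: "q x \<in> (\<Union>j<n. S j)" if "x \<in> X" for x
  proof (cases "x \<in> Z")
    case True
    then have "q x = (\<lambda>_. 0)" using q_Z by auto
    then show ?thesis using zero_S A(3) by auto
  qed (use that q_S X_eq in auto)
  have closed_Z: "closed Z" and closed_\<Delta>: "closed (\<Delta> j)" if "j < n" for j
    using compact_realize[OF L(2)] compact_hull[OF cV[OF that]]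
    by (auto simp: Z_def \<Delta>_def intro: compact_imp_closed)
  \<comment> \<open>For a coordinate of block \<open>j\<close>, the space is covered by two closed
    sets: the j-th cell, where the explicit formula holds, and the union of everything else, where
    the coordinate is 0.\<close>
  have cont: "continuous_on X (\<lambda>x. q x k)" for k
  proof (cases "fst k < n \<and> snd k \<le> m")
    case True
    then obtain j i where k: "k = (j, i)" "j < n" "i \<le> m" by (cases k) auto
    define R where "R = Z \<union> (\<Union>l\<in>{..<n} - {j}. \<Delta> l)"
    have XR: "X = \<Delta> j \<union> R" using k by (auto simp: X_eq R_def)
    have "closed R" unfolding R_def using closed_Z[OF A(3)] closed_\<Delta> by auto
    moreover have "q x k = 0" if "x \<in> R" for x
      using that q_Z q_other k unfolding R_def by (metis DiffD1 DiffD2 UN_E Un_iff insertI1 lessThan_iff)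
    then have "continuous_on R (\<lambda>x. q x k)"
      by (subst continuous_on_cong[where g = "\<lambda>_. 0"]) auto
    moreover have "continuous_on (\<Delta> j) (\<lambda>x. simplex_to_sphere m (b j x) i)"
      using k bsum by (intro continuous_on_simplex_to_sphere) (auto simp: b_def intro!: continuous_intros)
    then have "continuous_on (\<Delta> j) (\<lambda>x. q x k)"
      by (rule continuous_on_eq) (use k in \<open>auto simp: q_def\<close>)
    ultimately show ?thesis
      unfolding XR using closed_\<Delta>[OF k(2)] by (intro continuous_on_closed_Un) auto
  next
    case False
    then have "q x k = 0" for x by (cases k) (auto simp: q_def)
    then show ?thesis by simp
  qed
  have "(\<Union>j<n. S j) \<subseteq> q ` X"
  proof safe
    fix j y assume j: "j < n" and y: "y \<in> S j"
    show "y \<in> q ` X"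
    proof (cases "y (j, 0) = 0")
      case True
      \<comment> \<open>The sphere passes through the origin, and by its equation this is its only
        point with coordinate 0 equal to 0. Any point of \<open>L\<close> is a preimage, and
        \<open>L\<close> is nonempty as an absolute retract.\<close>
      have "(\<Sum>i\<in>{1..m}. (y (j, i))\<^sup>2) = 0"
        using y True by (simp add: S_def sum_atMost_split0)
      then have y0: "y (j, i) = 0" if "i \<le> m" for i
        using True that by (cases "i = 0") (auto simp: sum_nonneg_eq_0_iff)
      have "y (j', i) = 0" for j' i
        using y y0[of i] by (cases "j' = j \<and> i \<le> m") (auto simp: S_def)
      then have "y = (\<lambda>_. 0)" by auto
      moreover obtain x where "x \<in> Z" using L(3) by (auto simp: AR_ANR Z_def)
      moreover from this have "q x = (\<lambda>_. 0)" using q_Z by auto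
      ultimately show ?thesis using X_eq by (metis UnI1 image_eqI)
    next
      case False
      obtain \<beta> where \<beta>: "sum \<beta> {..m} = 1" "\<And>i. i \<le> m \<Longrightarrow> 0 < \<beta> i"
        "\<And>i. i \<le> m \<Longrightarrow> simplex_to_sphere m \<beta> i = y (j, i)"
        using simplex_to_sphere_surj[of "\<lambda>i. y (j, i)" m] y False by (auto simp: S_def)
      define x where "x = (\<Sum>i\<le>m. \<beta> i *\<^sub>R p (v j i))"
      have vj: "v j i \<in> c j" if "i \<le> m" for i using v[OF j] that by (auto simp: bij_betw_def)
      have bx: "b j x i = \<beta> i" if i: "i \<le> m" for i
      proof -
        have "b j x i = (\<Sum>l\<le>m. if l = i then \<beta> l else 0)"
          unfolding b_def x_def inner_sum_left
        proof (intro sum.cong refl)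
          fix l assume "l \<in> {..m}"
          then have "v j l = v j i \<longleftrightarrow> l = i" "v j l \<in> V" "v j i \<in> V"
            using v[OF j] i vj cV[OF j] by (auto simp: bij_betw_def inj_on_def)
          then show "\<beta> l *\<^sub>R p (v j l) \<bullet> p (v j i) = (if l = i then \<beta> l else 0)"
            by (simp add: inner_p)
        qed
        then show ?thesis using i by simp
      qed
      have x: "x \<in> \<Delta> j"
        unfolding x_def \<Delta>_def using vj \<beta>
        by (intro convex_sum) (auto intro: hull_inc less_imp_le)
      have "q x (k, i) = y (k, i)" for k i
      proof (cases "k = j \<and> i \<le> m")
        case True
        have mc: "min_coord m (b j x) = min_coord m \<beta>"
          unfolding min_coord_def using bx by (intro arg_cong[of _ _ Min] image_cong) auto
        have "sphere_denom m (b j x) = sphere_denom m \<beta>"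
          unfolding sphere_denom_def mc using bx by simp
        then have "simplex_to_sphere m (b j x) i = simplex_to_sphere m \<beta> i"
          using bx True by (simp add: simplex_to_sphere_def mc)
        then show ?thesis using True \<beta> x j by (simp add: q_def)
      next
        case False
        then show ?thesis using y q_S[OF j x] by (auto simp: S_def)
      qed
      then have "q x = y" by auto
      then show ?thesis using x X_eq j by blast
    qed
  qed
  then have q_onto: "q ` X = topspace (wedge_of_spheres n m)"
    using q_in topW by auto
  have fibre: "x = y \<or> x \<in> Z \<and> y \<in> Z" if xy: "x \<in> X" "y \<in> X" "q x = q y" for x y
  proof (rule ccontr)
    assume neg: "\<not> (x = y \<or> x \<in> Z \<and> y \<in> Z)"
    have "\<exists>j<n. x \<in> \<Delta> j \<and> y \<in> \<Delta> j \<and> x \<notin> Z \<and> y \<notin> Z"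
    proof -
      \<comment> \<open>Outside \<open>L\<close> the coordinate \<open>(j, 0)\<close> of the image
        is nonzero and so reveals the cell: a point with the same image must lie in the same cell,
        outside \<open>L\<close>.\<close>
      have *: "\<exists>j<n. x \<in> \<Delta> j \<and> y \<in> \<Delta> j \<and> x \<notin> Z \<and> y \<notin> Z"
        if x: "x \<in> X" "x \<notin> Z" and y: "y \<in> X" and qq: "q x = q y" for x y
      proof -
        obtain j where j: "j < n" "x \<in> \<Delta> j" using x X_eq by auto
        have nz: "q y (j, 0) \<noteq> 0" using q_0[OF j x(2)] qq by simp
        then have "y \<in> \<Delta> j" by (auto simp: q_def split: if_splits)
        moreover have "y \<notin> Z" using nz q_Z by auto
        ultimately show ?thesis using j x by auto
      qed
      show ?thesis
      proof (cases "x \<in> Z")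
        case True
        then show ?thesis using neg *[of y x] xy by auto
      qed (use *[of x y] xy in auto)
    qed
    then obtain j where j: "j < n" "x \<in> \<Delta> j" "y \<in> \<Delta> j" "x \<notin> Z" "y \<notin> Z" by auto
    have "min_coord m (b j x) > 0" "min_coord m (b j y) > 0"
      using min0[of j] min_nonneg[of j] j by (metis less_eq_real_def)+
    moreover have "simplex_to_sphere m (b j x) i = simplex_to_sphere m (b j y) i" if "i \<le> m" for i
      using fun_cong[OF xy(3), of "(j, i)"] j that by (simp add: q_def)
    ultimately have "b j x i = b j y i" if "i \<le> m" for i
      using simplex_to_sphere_inj bsum j that by metis
    then have "x \<bullet> p u = y \<bullet> p u" if "u \<in> c j" for u
      using v[OF j(1)] that by (force simp: bij_betw_def b_def)
    then have "(\<Sum>u\<in>c j. (x \<bullet> p u) *\<^sub>R p u) = (\<Sum>u\<in>c j. (y \<bullet> p u) *\<^sub>R p u)" by simp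
    then show False using neg j hull_iff[OF cV[OF j(1)]] by (simp add: \<Delta>_def)
  qed
  have LA: "L \<union> A \<subseteq> Pow V" using L(2) A(1) by auto
  show ?thesis
    unfolding X_def[symmetric]
  proof (rule homotopy_equivalent_quotient[where L = Z and q = q])
    show "compact X" "ANR X" unfolding X_def using compact_realize ANR_realize LA by auto
    show "closedin (top_of_set X) Z" using closed_Z[OF A(3)] X_eq by (auto intro: closed_subset)
    show "contractible Z" using L(3) by (simp add: AR_ANR Z_def)
    show "Hausdorff_space (wedge_of_spheres n m)"
      unfolding W by (intro Hausdorff_space_subtopology) (simp add: Hausdorff_space_product_topology)
    show "continuous_map (top_of_set X) (wedge_of_spheres n m) q"
      unfolding W continuous_map_into_powertop_subtopology using cont q_in by auto
    show "q ` X = topspace (wedge_of_spheres n m)" by (rule q_onto)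
    show "q x = q y" if "x \<in> Z" "y \<in> Z" for x y using q_Z that by auto
  qed (rule fibre)
qed

end

section \<open>Discrete Morse sequences\<close>

text \<open>An item (C, Some w) adds the two cells C and insert w C; an item (C, None) adds a critical
  cell. The empty set counts as a cell, so a sequence starting from no cells begins with ({}, Some w)
  unless its first item is ({}, None).\<close>

fun cells :: "'v set \<times> 'v option \<Rightarrow> 'v set set" where
  "cells (C, None) = {C}"
| "cells (C, Some w) = {C, insert w C}"

text \<open>For a pair only the facets through \<open>w\<close> are demanded: over a face-closed
  \<open>K\<close> they bring the facets of \<open>C\<close> with them, and
  \<open>C \<notin> K\<close> already keeps \<open>insert w C\<close> out. The order of the list
  takes the place of acyclicity of a matching.\<close>

fun morse_seq :: "'v set set \<Rightarrow> ('v set \<times> 'v option) list \<Rightarrow> bool" where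
  "morse_seq K [] \<longleftrightarrow> True"
| "morse_seq K ((C, None) # ps) \<longleftrightarrow> C \<notin> K \<and> (\<forall>x\<in>C. C - {x} \<in> K) \<and> morse_seq (insert C K) ps"
| "morse_seq K ((C, Some w) # ps) \<longleftrightarrow> w \<notin> C \<and> C \<notin> K \<and> (\<forall>x\<in>C. insert w (C - {x}) \<in> K) \<and>
     morse_seq ({C, insert w C} \<union> K) ps"

definition all_cells :: "('v set \<times> 'v option) list \<Rightarrow> 'v set set" where
  "all_cells ps = \<Union>(cells ` set ps)"

lemma all_cells_simps [simp]: "all_cells [] = {}" "all_cells (a # ps) = cells a \<union> all_cells ps"
  by (auto simp: all_cells_def)

lemma all_cells_append: "all_cells (ps @ qs) = all_cells ps \<union> all_cells qs"
  by (auto simp: all_cells_def)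

lemma morse_seq_append:
  "morse_seq K (ps @ qs) \<longleftrightarrow> morse_seq K ps \<and> morse_seq (K \<union> all_cells ps) qs"
proof (induction ps arbitrary: K)
  case (Cons a ps)
  obtain C z where a: "a = (C, z)" by fastforce
  show ?case by (cases z) (auto simp: a Cons.IH Un_ac insert_commute)
qed simp

lemma face_closed_insert:
  assumes "face_closed K" "\<And>x. x \<in> C \<Longrightarrow> C - {x} \<in> K"
  shows "face_closed (insert C K)"
  unfolding face_closed_def
proof (intro ballI allI impI)
  fix \<sigma> \<tau> assume "\<sigma> \<in> insert C K" "\<tau> \<subseteq> \<sigma>"
  then show "\<tau> \<in> insert C K"
  proof (cases "\<sigma> = C \<and> \<tau> \<noteq> C")
    case True
    then obtain x where "x \<in> C" "\<tau> \<subseteq> C - {x}" using \<open>\<tau> \<subseteq> \<sigma>\<close> by blast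
    then show ?thesis using assms face_closedD by blast
  qed (use assms(1) face_closedD \<open>\<sigma> \<in> insert C K\<close> \<open>\<tau> \<subseteq> \<sigma>\<close> in blast)
qed

lemma face_closed_expansion:
  assumes K: "face_closed K" and w: "w \<notin> C" and facets: "\<And>x. x \<in> C \<Longrightarrow> insert w (C - {x}) \<in> K"
  shows "face_closed ({C, insert w C} \<union> K)"
proof -
  have "C - {x} \<in> K" if "x \<in> C" for x using face_closedD[OF K facets[OF that]] by blast
  then have C: "face_closed (insert C K)" by (rule face_closed_insert[OF K])
  have "insert w C - {x} \<in> insert C K" if "x \<in> insert w C" for x
  proof (cases "x = w")
    case False
    then have "insert w C - {x} = insert w (C - {x})" by blast
    then show ?thesis using facets[of x] False that by simp
  qed (use w in simp)
  then have "face_closed (insert (insert w C) (insert C K))"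
    by (rule face_closed_insert[OF C])
  then show ?thesis by (simp add: insert_commute)
qed

lemma morse_seq_ConsD:
  assumes "morse_seq K ((C, z) # ps)"
  shows "C \<notin> K" "morse_seq (cells (C, z) \<union> K) ps"
    "face_closed K \<Longrightarrow> face_closed (cells (C, z) \<union> K)"
  using assms face_closed_insert[of K C] face_closed_expansion[of K _ C] by (cases z; auto)+

lemma morse_seq_face_closed:
  "morse_seq K ps \<Longrightarrow> face_closed K \<Longrightarrow> face_closed (K \<union> all_cells ps)"
proof (induction ps arbitrary: K)
  case (Cons a ps)
  obtain C z where a: "a = (C, z)" by fastforce
  show ?case
    using Cons.IH[OF morse_seq_ConsD(2,3)[OF Cons.prems(1)[unfolded a] ]] Cons.prems(2)
    by (simp add: a Un_ac)
qed simp

lemma morse_seq_notin: "morse_seq K ps \<Longrightarrow> (C, z) \<in> set ps \<Longrightarrow> C \<notin> K"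
proof (induction ps arbitrary: K)
  case (Cons a ps)
  obtain D y where a: "a = (D, y)" by fastforce
  then show ?case using Cons morse_seq_ConsD[of K D y ps] by fastforce
qed simp

lemma cells_cases: "\<sigma> \<in> cells (C, z) \<Longrightarrow> \<sigma> = C \<or> (\<exists>w. z = Some w \<and> \<sigma> = insert w C)"
  by (cases z) auto

lemma cells_fst: "C \<in> cells (C, z)"
  by (cases z) auto

text \<open>No cell is listed twice, since a face of a cell is listed no later than the cell itself.\<close>

lemma morse_seq_disjoint:
  "morse_seq K ps \<Longrightarrow> face_closed K \<Longrightarrow> (C, z) \<in> set ps \<Longrightarrow> (D, y) \<in> set ps \<Longrightarrow> C \<in> cells (D, y) \<Longrightarrow>
   C = D \<and> z = y"
proof (induction ps arbitrary: K)
  case (Cons a ps)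
  obtain B x where a: "a = (B, x)" by fastforce
  note 1 = morse_seq_ConsD[OF Cons.prems(1)[unfolded a]]
  have later: "E \<notin> cells (B, x) \<union> K" if "(E, v) \<in> set ps" for E v
    using morse_seq_notin[OF 1(2) that] .
  consider "(C, z) = (B, x)" "(D, y) = (B, x)" | "(C, z) = (B, x)" "(D, y) \<in> set ps"
    | "(C, z) \<in> set ps" "(D, y) = (B, x)" | "(C, z) \<in> set ps" "(D, y) \<in> set ps"
    using Cons.prems(3,4) a by auto
  then show ?case
  proof cases
    case 2
    \<comment> \<open>\<open>D\<close> is a face of \<open>C\<close>, so it is present as soon as
      \<open>C\<close> is, although its own item comes later in the list.\<close>
    have "D \<subseteq> C" using cells_cases[OF Cons.prems(5)] by blast
    then have "D \<in> cells (B, x) \<union> K"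
      using 2(1) face_closedD[OF 1(3)[OF Cons.prems(2)]] cells_fst[of B x] by blast
    then show ?thesis using later[OF 2(2)] by simp
  next
    case 3
    then show ?thesis using later[OF 3(1)] Cons.prems(5) by auto
  next
    case 4
    then show ?thesis using Cons.IH[OF 1(2) 1(3)[OF Cons.prems(2)]] Cons.prems(5) by blast
  qed simp
qed simp

lemma morse_seq_distinct: "morse_seq K ps \<Longrightarrow> distinct (map fst ps)"
proof (induction ps arbitrary: K)
  case (Cons a ps)
  obtain C z where a: "a = (C, z)" by fastforce
  note 1 = morse_seq_ConsD[OF Cons.prems[unfolded a]]
  have "C \<notin> fst ` set ps" using morse_seq_notin[OF 1(2)] cells_fst[of C z] by force
  then show ?case using Cons.IH[OF 1(2)] by (simp add: a)
qed simp

section \<open>Sorting a Morse sequence by dimension\<close>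

text \<open>The bound concerns the smaller member, of dimension below \<open>m\<close>. Its partner
  may have dimension \<open>m\<close>, the same as the critical cells, whose card is
  \<open>Suc m\<close>.\<close>

definition low_pair :: "nat \<Rightarrow> 'v set \<times> 'v option \<Rightarrow> bool" where
  "low_pair m a \<longleftrightarrow> snd a \<noteq> None \<and> card (fst a) \<le> m"

definition high_pair :: "nat \<Rightarrow> 'v set \<times> 'v option \<Rightarrow> bool" where
  "high_pair m a \<longleftrightarrow> snd a \<noteq> None \<and> m < card (fst a)"

text \<open>The facets demanded by a low pair have as many vertices as its smaller member, so at
  most \<open>m\<close>. Critical cells and high pairs contain no cell that small, hence dropping
  them removes none of these facets. In the induction \<open>K\<close> is the full complex so far
  and \<open>M\<close> its filtered counterpart.\<close>

lemma morse_seq_low_pairs: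
  assumes "morse_seq K ps" "\<And>\<sigma>. \<sigma> \<in> all_cells ps \<Longrightarrow> finite \<sigma>" "\<And>C. (C, None) \<in> set ps \<Longrightarrow> card C = Suc m"
    and "M \<subseteq> K" "\<And>\<sigma>. \<sigma> \<in> K \<Longrightarrow> card \<sigma> \<le> m \<Longrightarrow> \<sigma> \<in> M"
  shows "morse_seq M (filter (low_pair m) ps)"
    and "\<And>\<sigma>. \<sigma> \<in> K \<union> all_cells ps \<Longrightarrow> card \<sigma> \<le> m \<Longrightarrow> \<sigma> \<in> M \<union> all_cells (filter (low_pair m) ps)"
proof -
  have "morse_seq M (filter (low_pair m) ps) \<and>
    (\<forall>\<sigma>\<in>K \<union> all_cells ps. card \<sigma> \<le> m \<longrightarrow> \<sigma> \<in> M \<union> all_cells (filter (low_pair m) ps))"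
    using assms
  proof (induction ps arbitrary: K M)
    case (Cons a ps)
    obtain C z where a: "a = (C, z)" by fastforce
    note 1 = morse_seq_ConsD[OF Cons.prems(1)[unfolded a]]
    have fin: "finite C" using Cons.prems(2)[of C] cells_fst[of C z] by (simp add: a)
    note IH = Cons.IH[OF 1(2)]
    have prems: "\<And>\<sigma>. \<sigma> \<in> all_cells ps \<Longrightarrow> finite \<sigma>" "\<And>C. (C, None) \<in> set ps \<Longrightarrow> card C = Suc m"
      using Cons.prems(2,3) by auto
    show ?case
    proof (cases "low_pair m a")
      case True
      then obtain w where z: "z = Some w" and C: "card C \<le> m" by (auto simp: a low_pair_def)
      have w: "w \<notin> C" "\<And>x. x \<in> C \<Longrightarrow> insert w (C - {x}) \<in> K" "C \<notin> M"
        using Cons.prems(1,4) by (auto simp: a z)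
      have "insert w (C - {x}) \<in> M" if "x \<in> C" for x
      proof (rule Cons.prems(5)[OF w(2)[OF that]])
        show "card (insert w (C - {x})) \<le> m"
          using C fin that w(1) by (metis Diff_iff card_Suc_Diff1 card_insert_disjoint finite_Diff)
      qed
      moreover have "morse_seq (cells a \<union> M) (filter (low_pair m) ps) \<and>
        (\<forall>\<sigma>\<in>cells a \<union> K \<union> all_cells ps. card \<sigma> \<le> m \<longrightarrow> \<sigma> \<in> cells a \<union> M \<union> all_cells (filter (low_pair m) ps))"
        unfolding a by (rule IH[OF prems]) (use Cons.prems(4,5) in auto)
      ultimately show ?thesis using True w by (auto simp: a z)
    next
      case False
      have big: "m < card \<sigma>" if "\<sigma> \<in> cells a" for \<sigma>
      proof (cases z)
        case None
        then show ?thesis using Cons.prems(3)[of C] that by (simp add: a)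
      next
        case (Some w)
        then have "m < card C" using False by (simp add: a low_pair_def)
        also have "card C \<le> card \<sigma>"
          using that fin Some by (auto simp: a intro!: card_mono)
        finally show ?thesis .
      qed
      have "morse_seq M (filter (low_pair m) ps) \<and>
        (\<forall>\<sigma>\<in>cells a \<union> K \<union> all_cells ps. card \<sigma> \<le> m \<longrightarrow> \<sigma> \<in> M \<union> all_cells (filter (low_pair m) ps))"
        unfolding a
      proof (rule IH[OF prems])
        show "\<sigma> \<in> M" if "\<sigma> \<in> cells (C, z) \<union> K" "card \<sigma> \<le> m" for \<sigma>
          using that big[of \<sigma>] Cons.prems(5)[of \<sigma>] by (auto simp: a)
      qed (use Cons.prems(4) in auto)
      then show ?thesis using False by auto
    qed
  qed simp
  then show "morse_seq M (filter (low_pair m) ps)"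
    and "\<And>\<sigma>. \<sigma> \<in> K \<union> all_cells ps \<Longrightarrow> card \<sigma> \<le> m \<Longrightarrow> \<sigma> \<in> M \<union> all_cells (filter (low_pair m) ps)"
    by auto
qed

text \<open>High pairs may be postponed until all other cells are present: enlarging the complex
  preserves the condition on facets, and only the freshness of the smaller member has to be
  assumed.\<close>

lemma morse_seq_high_pairs:
  assumes "morse_seq K ps" "K \<subseteq> M"
    and "\<And>a. a \<in> set ps \<Longrightarrow> \<not> high_pair m a \<Longrightarrow> cells a \<subseteq> M"
    and "\<And>a. a \<in> set ps \<Longrightarrow> high_pair m a \<Longrightarrow> fst a \<notin> M"
  shows "morse_seq M (filter (high_pair m) ps)"
  using assms
proof (induction ps arbitrary: K M)
  case (Cons a ps)
  obtain C z where a: "a = (C, z)" by fastforce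
  note 1 = morse_seq_ConsD[OF Cons.prems(1)[unfolded a]]
  show ?case
  proof (cases "high_pair m a")
    case True
    then obtain w where z: "z = Some w" by (auto simp: a high_pair_def)
    have "morse_seq (cells (C, z) \<union> M) (filter (high_pair m) ps)"
    proof (rule Cons.IH[OF 1(2)])
      fix b assume b: "b \<in> set ps" "high_pair m b"
      then show "fst b \<notin> cells (C, z) \<union> M"
        using Cons.prems(4)[of b] morse_seq_notin[OF 1(2), of "fst b" "snd b"] by auto
    qed (use Cons.prems(2,3) in auto)
    then show ?thesis
      using True Cons.prems(1,2) Cons.prems(4)[of a] by (auto simp: a z)
  next
    case False
    have "morse_seq M (filter (high_pair m) ps)"
      by (rule Cons.IH[OF 1(2)]) (use False Cons.prems(2-4) a in auto)
    then show ?thesis using False by simp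
  qed
qed simp

section \<open>The homotopy type determined by a Morse sequence\<close>

context basis_vertices begin

text \<open>Elementary expansions are iterated. Having \<open>{}\<close> in \<open>K\<close> forces
  every \<open>C\<close> to be nonempty; the pair of the empty set would create an isolated point
  instead of an expansion.\<close>

lemma
  assumes "morse_seq K ps" "face_closed K" "{} \<in> K" "K \<union> all_cells ps \<subseteq> Pow V"
    and "\<And>a. a \<in> set ps \<Longrightarrow> snd a \<noteq> None"
  shows AR_morse_seq: "AR (realize p K) \<Longrightarrow> AR (realize p (K \<union> all_cells ps))"
    and morse_seq_homotopy_equivalent: "top_of_set (realize p (K \<union> all_cells ps))
      homotopy_equivalent_space top_of_set (realize p K)"
proof -
  have "(AR (realize p K) \<longrightarrow> AR (realize p (K \<union> all_cells ps))) \<and>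
    top_of_set (realize p (K \<union> all_cells ps)) homotopy_equivalent_space top_of_set (realize p K)"
    using assms
  proof (induction ps arbitrary: K)
    case (Cons a ps)
    obtain C w where a: "a = (C, Some w)" using Cons.prems(5)[of a] by (cases a) auto
    note 1 = morse_seq_ConsD[OF Cons.prems(1)[unfolded a]]
    have K: "face_closed K" "K \<subseteq> Pow V" "insert w C \<subseteq> V" "w \<notin> C" "C \<notin> K" "C \<noteq> {}"
      "\<And>x. x \<in> C \<Longrightarrow> insert w (C - {x}) \<in> K"
      using Cons.prems(1-4) by (auto simp: a)
    have eq: "K \<union> all_cells (a # ps) = cells (C, Some w) \<union> K \<union> all_cells ps" by (auto simp: a)
    have "(AR (realize p (cells (C, Some w) \<union> K)) \<longrightarrow> AR (realize p (K \<union> all_cells (a # ps)))) \<and>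
        top_of_set (realize p (K \<union> all_cells (a # ps)))
          homotopy_equivalent_space top_of_set (realize p (cells (C, Some w) \<union> K))"
      unfolding eq
      by (rule Cons.IH[OF 1(2) 1(3)[OF K(1)]]) (use Cons.prems(3-5) a in auto)
    then show ?case
      using AR_expansion[OF K] expansion_homotopy_equivalent[OF K] homotopy_eqv_trans by auto
  qed (simp add: homotopy_equivalent_space_refl)
  then show "AR (realize p K) \<Longrightarrow> AR (realize p (K \<union> all_cells ps))"
    and "top_of_set (realize p (K \<union> all_cells ps)) homotopy_equivalent_space top_of_set (realize p K)"
    by auto
qed

theorem morse_seq_wedge_of_spheres:
  assumes ps: "morse_seq {} ps" and V: "all_cells ps \<subseteq> Pow V"
    and critical: "\<And>C. (C, None) \<in> set ps \<Longrightarrow> card C = Suc m"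
    and n: "length (filter (\<lambda>a. snd a = None) ps) = n" "n > 0"
  shows "top_of_set (realize p (all_cells ps)) homotopy_equivalent_space wedge_of_spheres n m"
proof -
  define L where "L = all_cells (filter (low_pair m) ps)"
  define A where "A = {C. (C, None) \<in> set ps}"
  define hs where "hs = filter (high_pair m) ps"
  have fc0: "face_closed {}" by (simp add: face_closed_def)
  have fin: "finite \<sigma>" if "\<sigma> \<in> all_cells ps" for \<sigma>
    using that V finite_V finite_subset by blast
  have L_ms: "morse_seq {} (filter (low_pair m) ps)"
    and L_low: "\<And>\<sigma>. \<sigma> \<in> all_cells ps \<Longrightarrow> card \<sigma> \<le> m \<Longrightarrow> \<sigma> \<in> L"
    using morse_seq_low_pairs[OF ps fin critical, where M = "{}"] by (auto simp: L_def)
  have L_sub: "L \<subseteq> all_cells ps" and A_sub: "A \<subseteq> all_cells ps"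
    by (force simp: L_def A_def all_cells_def)+
  have L_closed: "face_closed L" using morse_seq_face_closed[OF L_ms fc0] by (simp add: L_def)
  \<comment> \<open>If the first cell of an item occurs in another item, the two items coincide. So
    critical cells and the smaller members of high pairs stay outside \<open>L\<close>.\<close>
  have notL: "C \<notin> L" if "(C, z) \<in> set ps" "\<not> low_pair m (C, z)" for C z
  proof
    assume "C \<in> L"
    then obtain D y where D: "(D, y) \<in> set ps" "low_pair m (D, y)" "C \<in> cells (D, y)"
      by (auto simp: L_def all_cells_def)
    then show False using morse_seq_disjoint[OF ps fc0 that(1) D(1,3)] that(2) by simp
  qed
  obtain a where "a \<in> set ps" using n by (cases ps) auto
  then have "fst a \<in> all_cells ps"
    unfolding all_cells_def using cells_fst[of "fst a" "snd a"] by force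
  then have "{} \<in> all_cells ps"
    using morse_seq_face_closed[OF ps fc0] face_closedD by (metis Un_empty_left empty_subsetI equals0I)
  then have empty_L: "{} \<in> L" using L_low by simp
  have L_AR: "AR (realize p L)"
  proof (cases "filter (low_pair m) ps")
    case Nil
    then show ?thesis using empty_L by (simp add: L_def)
  next
    case (Cons a qs)
    have "a \<in> set (filter (low_pair m) ps)" unfolding Cons by simp
    then have "low_pair m a" by simp
    then obtain C w where a: "a = (C, Some w)" by (cases a) (auto simp: low_pair_def)
    \<comment> \<open>Nothing precedes the first pair, so \<open>C\<close> can have no facets
      through \<open>w\<close> to be demanded. The construction therefore starts from the single
      point \<open>p w\<close>.\<close>
    have C: "C = {}" using L_ms by (auto simp: Cons a)
    have "morse_seq (cells a) qs" using L_ms unfolding Cons a C by simp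
    moreover have "face_closed (cells a)" by (auto simp: face_closed_def a C)
    moreover have "AR (realize p (cells a))" by (simp add: realize_def a C AR_singleton)
    moreover have "cells a \<union> all_cells qs = L" by (simp add: L_def Cons)
    moreover have "snd b \<noteq> None" if "b \<in> set qs" for b
    proof -
      have "b \<in> set (filter (low_pair m) ps)" unfolding Cons using that by simp
      then show ?thesis by (simp add: low_pair_def)
    qed
    ultimately show ?thesis
      using AR_morse_seq[of "cells a" qs] L_sub V by (auto simp: a C)
  qed
  have "card A = n"
  proof -
    have "A = fst ` set (filter (\<lambda>a. snd a = None) ps)" by (force simp: A_def)
    moreover have "distinct (map fst (filter (\<lambda>a. snd a = None) ps))"
      using morse_seq_distinct[OF ps] by (rule distinct_map_filter)
    ultimately show ?thesis using n by (metis distinct_card length_map set_map)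
  qed
  moreover have "C - {x} \<in> L" if "C \<in> A" "x \<in> C" for C x
  proof (rule L_low)
    have "C \<in> all_cells ps" using that A_sub by auto
    then show "C - {x} \<in> all_cells ps"
      using morse_seq_face_closed[OF ps fc0] face_closedD[of "all_cells ps" C] by auto
    show "card (C - {x}) \<le> m" using critical that by (simp add: A_def)
  qed
  ultimately have "top_of_set (realize p (L \<union> A)) homotopy_equivalent_space wedge_of_spheres n m"
    using L_closed L_sub A_sub V L_AR n critical notL
    by (intro wedge_of_cells) (auto simp: A_def low_pair_def)
  moreover have "top_of_set (realize p (L \<union> A \<union> all_cells hs)) homotopy_equivalent_space top_of_set (realize p (L \<union> A))"
  proof (rule morse_seq_homotopy_equivalent)
    show "morse_seq (L \<union> A) hs"
      unfolding hs_def
    proof (rule morse_seq_high_pairs[OF ps])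
      show "cells a \<subseteq> L \<union> A" if "a \<in> set ps" "\<not> high_pair m a" for a
      proof (cases "low_pair m a")
        case True
        then show ?thesis using that(1) by (auto simp: L_def all_cells_def)
      next
        case False
        then have "snd a = None" using that(2) by (auto simp: low_pair_def high_pair_def)
        then show ?thesis using that(1) by (cases a) (simp add: A_def)
      qed
      show "fst a \<notin> L \<union> A" if a: "a \<in> set ps" "high_pair m a" for a
      proof -
        have "fst a \<notin> L" using notL[of "fst a" "snd a"] a by (auto simp: low_pair_def high_pair_def)
        moreover have "fst a \<notin> A"
          using morse_seq_disjoint[OF ps fc0, of "fst a" "snd a" "fst a" None] a
          by (auto simp: A_def high_pair_def)
        ultimately show ?thesis by simp
      qed
    qed simp
    show "face_closed (L \<union> A)"
      unfolding face_closed_def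
    proof (intro ballI allI impI)
      fix \<sigma> \<tau> assume st: "\<sigma> \<in> L \<union> A" "\<tau> \<subseteq> \<sigma>"
      show "\<tau> \<in> L \<union> A"
      proof (cases "\<sigma> \<in> L \<or> \<tau> = \<sigma>")
        case False
        then have \<sigma>: "\<sigma> \<in> A" using st by auto
        \<comment> \<open>A proper face of a critical cell has at most \<open>m\<close> vertices,
          and all cells of that size are in \<open>L\<close>.\<close>
        then have "card \<tau> < card \<sigma>" using False st fin A_sub by (intro psubset_card_mono) auto
        moreover have "\<tau> \<in> all_cells ps"
          using morse_seq_face_closed[OF ps fc0] face_closedD[of "all_cells ps" \<sigma>] \<sigma> A_sub st by auto
        ultimately show ?thesis using L_low critical \<sigma> by (auto simp: A_def)
      qed (use st face_closedD[OF L_closed] in blast)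
    qed
    show "{} \<in> L \<union> A" using empty_L by simp
    have "all_cells hs \<subseteq> all_cells ps" by (auto simp: hs_def all_cells_def)
    then show "L \<union> A \<union> all_cells hs \<subseteq> Pow V" using L_sub A_sub V by blast
    show "snd a \<noteq> None" if "a \<in> set hs" for a using that by (simp add: hs_def high_pair_def)
  qed
  moreover have "L \<union> A \<union> all_cells hs = all_cells ps"
  proof
    show "all_cells ps \<subseteq> L \<union> A \<union> all_cells hs"
    proof
      fix \<sigma> assume "\<sigma> \<in> all_cells ps"
      then obtain C z where C: "(C, z) \<in> set ps" "\<sigma> \<in> cells (C, z)" by (auto simp: all_cells_def)
      consider "z = None" | "low_pair m (C, z)" | "high_pair m (C, z)"
        by (cases z; cases "card C \<le> m") (auto simp: low_pair_def high_pair_def)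
      then show "\<sigma> \<in> L \<union> A \<union> all_cells hs"
      proof cases
        case 1
        then show ?thesis using C by (auto simp: A_def)
      next
        case 2
        then have "\<sigma> \<in> L" using C unfolding L_def all_cells_def by force
        then show ?thesis by simp
      next
        case 3
        then have "\<sigma> \<in> all_cells hs" using C unfolding hs_def all_cells_def by force
        then show ?thesis by simp
      qed
    qed
  qed (use L_sub A_sub in \<open>auto simp: hs_def all_cells_def\<close>)
  ultimately show ?thesis using homotopy_eqv_trans by metis
qed

end

section \<open>Matching trees\<close>

text \<open>A node of the tree stands for the cells \<open>A \<union> \<sigma>\<close> with \<open>\<sigma> \<subseteq> S\<close> independent for the relation R.
  The first subtree of Branch takes the cells without v and that of Split those not containing both
  u and v, which amounts to making u and v adjacent. The number k in the validity check is the
  number of vertices by which A still falls short of a critical cell.\<close>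

datatype 'v mtree =
    Crit
  | Pivot 'v
  | Branch 'v "'v mtree" "'v mtree"
  | Split 'v 'v "'v mtree" "'v mtree"

definition independent_in :: "('v \<Rightarrow> 'v \<Rightarrow> bool) \<Rightarrow> 'v set \<Rightarrow> bool" where
  "independent_in R \<sigma> \<longleftrightarrow> (\<forall>x\<in>\<sigma>. \<forall>y\<in>\<sigma>. \<not> R x y)"

definition ind_cells :: "'v set \<Rightarrow> ('v \<Rightarrow> 'v \<Rightarrow> bool) \<Rightarrow> 'v set \<Rightarrow> 'v set set" where
  "ind_cells A R S = (\<union>) A ` {\<sigma>. \<sigma> \<subseteq> S \<and> independent_in R \<sigma>}"

text \<open>The relation is an argument because \<open>Split\<close> adds an edge to it, and
  \<open>S\<close> is a list so that the test can be evaluated. Only \<open>Crit\<close> demands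
  that \<open>k\<close> be used up exactly; the pairs below a \<open>Pivot\<close> may have any
  size.\<close>

primrec valid_tree :: "'v mtree \<Rightarrow> ('v \<Rightarrow> 'v \<Rightarrow> bool) \<Rightarrow> nat \<Rightarrow> 'v list \<Rightarrow> bool" where
  "valid_tree Crit R k S \<longleftrightarrow> S = [] \<and> k = 0"
| "valid_tree (Pivot w) R k S \<longleftrightarrow> w \<in> set S \<and> (\<forall>u\<in>set S. \<not> R w u)"
| "valid_tree (Branch v s t) R k S \<longleftrightarrow> v \<in> set S \<and> k \<noteq> 0 \<and>
     valid_tree s R k (filter (\<lambda>u. u \<noteq> v) S) \<and>
     valid_tree t R (k - 1) (filter (\<lambda>u. u \<noteq> v \<and> \<not> R v u) S)"
| "valid_tree (Split u v s t) R k S \<longleftrightarrow> u \<in> set S \<and> v \<in> set S \<and> u \<noteq> v \<and> \<not> R u v \<and> 1 < k \<and>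
     valid_tree s (\<lambda>x y. R x y \<or> x = u \<and> y = v \<or> x = v \<and> y = u) k S \<and>
     valid_tree t R (k - 2) (filter (\<lambda>x. x \<noteq> u \<and> x \<noteq> v \<and> \<not> R u x \<and> \<not> R v x) S)"

primrec critical_count :: "'v mtree \<Rightarrow> nat" where
  "critical_count Crit = 1"
| "critical_count (Pivot w) = 0"
| "critical_count (Branch v s t) = critical_count s + critical_count t"
| "critical_count (Split u v s t) = critical_count s + critical_count t"

lemma ind_cellsE:
  assumes "\<sigma> \<in> ind_cells A R S"
  obtains \<tau> where "\<sigma> = A \<union> \<tau>" "\<tau> \<subseteq> S" "independent_in R \<tau>"
  using assms by (auto simp: ind_cells_def)

lemma mem_ind_cells:
  assumes "A \<inter> S = {}"
  shows "\<sigma> \<in> ind_cells A R S \<longleftrightarrow> A \<subseteq> \<sigma> \<and> \<sigma> - A \<subseteq> S \<and> independent_in R (\<sigma> - A)"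
proof
  assume "\<sigma> \<in> ind_cells A R S"
  then obtain \<tau> where \<tau>: "\<sigma> = A \<union> \<tau>" "\<tau> \<subseteq> S" "independent_in R \<tau>" by (rule ind_cellsE)
  moreover have "\<sigma> - A = \<tau>" using \<tau> assms by blast
  ultimately show "A \<subseteq> \<sigma> \<and> \<sigma> - A \<subseteq> S \<and> independent_in R (\<sigma> - A)" by simp
next
  assume "A \<subseteq> \<sigma> \<and> \<sigma> - A \<subseteq> S \<and> independent_in R (\<sigma> - A)"
  moreover from this have "\<sigma> = A \<union> (\<sigma> - A)" by blast
  ultimately show "\<sigma> \<in> ind_cells A R S" unfolding ind_cells_def by blast
qed

lemma independent_in_insert:
  assumes "symp R" "\<not> R v v"
  shows "independent_in R (insert v \<sigma>) \<longleftrightarrow> independent_in R \<sigma> \<and> (\<forall>x\<in>\<sigma>. \<not> R v x)"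
  using assms by (auto simp: independent_in_def dest: sympD)

lemma independent_in_mono: "independent_in R \<sigma> \<Longrightarrow> \<tau> \<subseteq> \<sigma> \<Longrightarrow> independent_in R \<tau>"
  by (auto simp: independent_in_def)

lemma ind_cells_Branch:
  assumes R: "symp R" "\<not> R v v" and A: "A \<inter> S = {}" and v: "v \<in> S"
  shows "ind_cells A R S = ind_cells A R (S - {v}) \<union> ind_cells (insert v A) R {u \<in> S. u \<noteq> v \<and> \<not> R v u}"
proof (rule set_eqI)
  fix \<sigma>
  have v': "v \<notin> A" using A v by auto
  have 1: "A \<inter> (S - {v}) = {}" "insert v A \<inter> {u \<in> S. u \<noteq> v \<and> \<not> R v u} = {}" using A by auto
  show "\<sigma> \<in> ind_cells A R S \<longleftrightarrow> \<sigma> \<in> ind_cells A R (S - {v}) \<union> ind_cells (insert v A) R {u \<in> S. u \<noteq> v \<and> \<not> R v u}"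
  proof (cases "v \<in> \<sigma>")
    case True
    then have "\<sigma> - A = insert v (\<sigma> - insert v A)" using v' by blast
    then show ?thesis
      unfolding Un_iff mem_ind_cells[OF A] mem_ind_cells[OF 1(1)] mem_ind_cells[OF 1(2)]
      using True v v' independent_in_insert[OF R, of "\<sigma> - insert v A"] by auto
  next
    case False
    then show ?thesis
      unfolding Un_iff mem_ind_cells[OF A] mem_ind_cells[OF 1(1)] mem_ind_cells[OF 1(2)]
      using v' by auto
  qed
qed

text \<open>An extra edge between \<open>u\<close> and \<open>v\<close> excludes precisely the
  independent sets containing both. \<open>tree16\<close> uses such a node for the Hasse edges
  \<open>(5,13)\<close> and \<open>(6,14)\<close>, which share no node.\<close>

lemma ind_cells_Split:
  assumes R: "symp R" "\<And>x. \<not> R x x" and A: "A \<inter> S = {}" and uv: "u \<in> S" "v \<in> S" "u \<noteq> v" "\<not> R u v"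
  shows "ind_cells A R S = ind_cells A (\<lambda>x y. R x y \<or> x = u \<and> y = v \<or> x = v \<and> y = u) S \<union>
    ind_cells (insert u (insert v A)) R {x \<in> S. x \<noteq> u \<and> x \<noteq> v \<and> \<not> R u x \<and> \<not> R v x}"
    (is "_ = ind_cells A ?R S \<union> ind_cells ?A R ?S")
proof (rule set_eqI)
  fix \<sigma>
  have uv': "u \<notin> A" "v \<notin> A" using A uv by auto
  have 1: "?A \<inter> ?S = {}" using A by auto
  show "\<sigma> \<in> ind_cells A R S \<longleftrightarrow> \<sigma> \<in> ind_cells A ?R S \<union> ind_cells ?A R ?S"
  proof (cases "u \<in> \<sigma> \<and> v \<in> \<sigma>")
    case True
    then have "\<sigma> - A = insert u (insert v (\<sigma> - ?A))" using uv' by blast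
    then have "independent_in R (\<sigma> - A) \<longleftrightarrow>
        independent_in R (\<sigma> - ?A) \<and> (\<forall>x\<in>\<sigma> - ?A. \<not> R u x \<and> \<not> R v x)"
      using independent_in_insert[OF R(1), of v "\<sigma> - ?A"] R(2) uv(4)
        independent_in_insert[OF R(1), of u "insert v (\<sigma> - ?A)"] by auto
    moreover have "\<not> independent_in ?R (\<sigma> - A)"
      using True uv' by (auto simp: independent_in_def)
    ultimately show ?thesis
      unfolding Un_iff mem_ind_cells[OF A] mem_ind_cells[OF 1] using True uv uv' by blast
  next
    case False
    then have "independent_in ?R (\<sigma> - A) \<longleftrightarrow> independent_in R (\<sigma> - A)"
      by (auto simp: independent_in_def)
    then show ?thesis
      unfolding Un_iff mem_ind_cells[OF A] mem_ind_cells[OF 1] using False by blast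
  qed
qed

text \<open>Applied with \<open>N\<close> the cells containing \<open>v\<close> (or both
  \<open>u\<close> and \<open>v\<close>) and \<open>M\<close> the others: no cell of
  \<open>M\<close> has a face in \<open>N\<close>, so \<open>M\<close> can be listed first.\<close>

lemma face_closed_Un_part:
  assumes closed: "face_closed (K \<union> (M \<union> N))" and K: "face_closed K"
    and MN: "\<And>\<sigma> \<tau>. \<sigma> \<in> M \<Longrightarrow> \<tau> \<in> N \<Longrightarrow> \<not> \<tau> \<subseteq> \<sigma>"
  shows "face_closed (K \<union> M)"
  unfolding face_closed_def
proof (intro ballI allI impI)
  fix \<sigma> \<tau> assume st: "\<sigma> \<in> K \<union> M" "\<tau> \<subseteq> \<sigma>"
  then have "\<tau> \<in> K \<union> (M \<union> N)" using face_closedD[OF closed, of \<sigma> \<tau>] by blast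
  then show "\<tau> \<in> K \<union> M" using st MN face_closedD[OF K] by blast
qed

text \<open>The pairs of a pivot are listed by increasing cardinality.\<close>

lemma morse_seq_Pivot:
  assumes A: "finite A" "finite S" "A \<inter> S = {}" and K: "face_closed K"
    and closed: "face_closed (K \<union> ind_cells A R S)" and disj: "K \<inter> ind_cells A R S = {}"
    and R: "symp R" and w: "w \<in> S" "\<And>u. u \<in> S \<Longrightarrow> \<not> R w u"
  shows "\<exists>ps. morse_seq K ps \<and> all_cells ps = ind_cells A R S \<and> (\<forall>a\<in>set ps. snd a \<noteq> None)"
proof -
  define M where "M = ind_cells A R (S - {w})"
  define cf where "cf = (\<lambda>x y. card x \<le> card (y::'a set))"
  have AS: "A \<inter> (S - {w}) = {}" using A(3) by auto
  have M_iff: "\<sigma> \<in> M \<longleftrightarrow> A \<subseteq> \<sigma> \<and> \<sigma> - A \<subseteq> S - {w} \<and> independent_in R (\<sigma> - A)" for \<sigma>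
    unfolding M_def by (rule mem_ind_cells[OF AS])
  have wM: "w \<notin> \<sigma>" if "\<sigma> \<in> M" for \<sigma> using that w(1) A(3) M_iff by blast
  have insert_M: "insert w \<sigma> \<in> ind_cells A R S \<longleftrightarrow> \<sigma> \<in> M" if "w \<notin> \<sigma>" for \<sigma>
  proof -
    have "insert w \<sigma> - A = insert w (\<sigma> - A)" using w(1) A(3) by blast
    then show ?thesis
      unfolding M_iff mem_ind_cells[OF A(3)]
      using independent_in_insert[OF R w(2)[OF w(1)], of "\<sigma> - A"] w A(3) that by auto
  qed
  have M_sub: "M \<subseteq> ind_cells A R S" by (auto simp: M_def ind_cells_def)
  have "M \<subseteq> Pow (A \<union> S)" using M_iff by blast
  then have finM: "finite M" using A finite_subset by blast
  then obtain xs where xs: "set xs = M" "distinct xs" using finite_distinct_list by metis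
  define ys where "ys = sort_key card xs"
  have ys: "set ys = M" "distinct ys" "sorted (map card ys)" using xs by (simp_all add: ys_def)
  have fin: "finite \<sigma>" if "\<sigma> \<in> M" for \<sigma> using that \<open>M \<subseteq> Pow (A \<union> S)\<close> A finite_subset by blast
  \<comment> \<open>Removing a vertex of \<open>A\<close> leaves the current part and so lands in
    \<open>K\<close>; removing any other vertex gives the larger member of a pair whose smaller
    member has fewer elements than \<open>C\<close>.\<close>
  have facets: "insert w (C - {x}) \<in> K \<union> insert w ` {\<tau> \<in> M. card \<tau> < card C}"
    if C: "C \<in> M" and x: "x \<in> C" for C x
  proof -
    have "insert w C \<in> ind_cells A R S" using insert_M wM C by simp
    then have "insert w (C - {x}) \<in> K \<union> ind_cells A R S"
      using closed face_closedD[of "K \<union> ind_cells A R S" "insert w C" "insert w (C - {x})"] by blast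
    moreover have "C - {x} \<in> M" if "insert w (C - {x}) \<in> ind_cells A R S"
      using insert_M[of "C - {x}"] that wM[OF C] by simp
    moreover have "card (C - {x}) < card C" using C x fin by (meson card_Diff1_less)
    ultimately show ?thesis by blast
  qed
  have cells_eq: "all_cells (map (\<lambda>C. (C, Some w)) zs) = set zs \<union> insert w ` set zs" for zs
    by (induction zs) auto
  have "morse_seq K (map (\<lambda>C. (C, Some w)) zs)" if "ys = zs @ us" for zs us
    using that
  proof (induction zs arbitrary: us rule: rev_induct)
    case (snoc C zs)
    have C: "C \<in> M" using ys(1) snoc.prems by auto
    have low: "\<tau> \<in> set zs" if "\<tau> \<in> M" "card \<tau> < card C" for \<tau>
    proof (rule ccontr)
      assume "\<tau> \<notin> set zs"
      then have "\<tau> \<in> set (C # us)" using ys(1) snoc.prems that(1) by auto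
      then have "card C \<le> card \<tau>" using ys(3) snoc.prems by (auto simp: sorted_append)
      then show False using that by simp
    qed
    have "C \<notin> K" using C M_sub disj by blast
    moreover have "C \<notin> set zs" using ys(2) snoc.prems by auto
    moreover have "C \<notin> insert w ` set zs" using wM[OF C] by auto
    moreover have "\<forall>x\<in>C. insert w (C - {x}) \<in> K \<union> insert w ` set zs"
      using facets[OF C] low by blast
    ultimately show ?case
      using snoc.IH[of "C # us"] snoc.prems wM[OF C] by (auto simp: morse_seq_append cells_eq)
  qed simp
  then have "morse_seq K (map (\<lambda>C. (C, Some w)) ys)" by simp
  moreover have "all_cells (map (\<lambda>C. (C, Some w)) ys) = ind_cells A R S"
  proof
    show "ind_cells A R S \<subseteq> all_cells (map (\<lambda>C. (C, Some w)) ys)"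
    proof
      fix \<sigma> assume \<sigma>: "\<sigma> \<in> ind_cells A R S"
      show "\<sigma> \<in> all_cells (map (\<lambda>C. (C, Some w)) ys)"
      proof (cases "w \<in> \<sigma>")
        case True
        then have e: "insert w (\<sigma> - {w}) = \<sigma>" by blast
        then have "\<sigma> - {w} \<in> M" using insert_M[of "\<sigma> - {w}"] \<sigma> by simp
        then have "\<sigma> \<in> insert w ` M" using e by (metis image_eqI)
        then show ?thesis by (simp add: cells_eq ys)
      next
        case False
        then have "\<sigma> \<in> M" using \<sigma> unfolding M_iff mem_ind_cells[OF A(3)] by blast
        then show ?thesis by (simp add: cells_eq ys)
      qed
    qed
    have "insert w ` M \<subseteq> ind_cells A R S" using insert_M wM by blast
    then show "all_cells (map (\<lambda>C. (C, Some w)) ys) \<subseteq> ind_cells A R S"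
      using M_sub by (simp add: cells_eq ys)
  qed
  ultimately show ?thesis by (intro exI[of _ "map (\<lambda>C. (C, Some w)) ys"]) auto
qed

text \<open>\<open>K\<close> collects the parts already listed. It is face-closed both alone and
  together with the current part, which supplies every facet that an item demands. The invariant
  \<open>card A + k = m\<close> gives a critical leaf, where \<open>k = 0\<close>, exactly
  \<open>m\<close> vertices.\<close>

lemma valid_tree_morse_seq:
  assumes "valid_tree t R k S" "symp R" "\<And>x. \<not> R x x" "finite A" "card A + k = m" "A \<inter> set S = {}"
    and "face_closed K" "face_closed (K \<union> ind_cells A R (set S))" "K \<inter> ind_cells A R (set S) = {}"
  shows "\<exists>ps. morse_seq K ps \<and> all_cells ps = ind_cells A R (set S) \<and>
    (\<forall>C. (C, None) \<in> set ps \<longrightarrow> card C = m) \<and> length (filter (\<lambda>a. snd a = None) ps) = critical_count t"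
  using assms
proof (induction t arbitrary: R k S A K)
  case Crit
  have eq: "ind_cells A R (set S) = {A}"
    using Crit.prems(1) by (auto simp: ind_cells_def independent_in_def)
  have "A - {x} \<in> K" if "x \<in> A" for x
    using face_closedD[OF Crit.prems(8), of A "A - {x}"] that by (auto simp: eq)
  moreover have "A \<notin> K" using Crit.prems(9) unfolding eq by simp
  moreover have "card A = m" using Crit.prems(1,5) by simp
  ultimately show ?case by (intro exI[of _ "[(A, None)]"]) (auto simp: eq)
next
  case (Pivot w)
  obtain ps where ps: "morse_seq K ps" "all_cells ps = ind_cells A R (set S)" "\<forall>a\<in>set ps. snd a \<noteq> None"
    using morse_seq_Pivot[of A "set S" K R w] Pivot.prems by auto
  moreover have "filter (\<lambda>a. snd a = None) ps = []" using ps(3) by (simp add: filter_empty_conv)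
  moreover have "\<forall>C. (C, None) \<notin> set ps" using ps(3) by (metis snd_conv)
  ultimately show ?case by (intro exI[of _ ps]) simp
next
  case (Branch v s t)
  let ?S1 = "filter (\<lambda>u. u \<noteq> v) S" and ?S2 = "filter (\<lambda>u. u \<noteq> v \<and> \<not> R v u) S"
  have v: "v \<in> set S" "v \<notin> A" using Branch.prems by auto
  define M1 M2 where "M1 = ind_cells A R (set ?S1)" and "M2 = ind_cells (insert v A) R (set ?S2)"
  have e1: "set ?S1 = set S - {v}" "set ?S2 = {u \<in> set S. u \<noteq> v \<and> \<not> R v u}" by auto
  have M: "ind_cells A R (set S) = M1 \<union> M2"
    using ind_cells_Branch[OF Branch.prems(2,3,6) v(1)] unfolding M1_def M2_def e1 by simp
  have vM1: "v \<notin> \<sigma>" if "\<sigma> \<in> M1" for \<sigma> using that v by (auto simp: M1_def ind_cells_def)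
  have vM2: "v \<in> \<sigma>" if "\<sigma> \<in> M2" for \<sigma> using that by (auto simp: M2_def ind_cells_def)
  have c1: "face_closed (K \<union> M1)"
    using Branch.prems(8)[unfolded M] Branch.prems(7)
    by (rule face_closed_Un_part) (use vM1 vM2 in blast)
  obtain ps where ps: "morse_seq K ps" "all_cells ps = M1" "\<forall>C. (C, None) \<in> set ps \<longrightarrow> card C = m"
    "length (filter (\<lambda>a. snd a = None) ps) = critical_count s"
    using Branch.IH(1)[of R k ?S1 A K] Branch.prems c1 by (auto simp: M M1_def)
  have "\<exists>qs. morse_seq (K \<union> M1) qs \<and> all_cells qs = ind_cells (insert v A) R (set ?S2) \<and>
    (\<forall>C. (C, None) \<in> set qs \<longrightarrow> card C = m) \<and> length (filter (\<lambda>a. snd a = None) qs) = critical_count t"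
  proof (rule Branch.IH(2))
    show "(K \<union> M1) \<inter> ind_cells (insert v A) R (set ?S2) = {}"
      using Branch.prems(9) vM1 vM2 unfolding M M2_def[symmetric] by blast
    show "face_closed (K \<union> M1 \<union> ind_cells (insert v A) R (set ?S2))"
      using Branch.prems(8) unfolding M M2_def[symmetric] by (simp add: Un_assoc)
  qed (use Branch.prems v c1 in auto)
  then obtain qs where "morse_seq (K \<union> M1) qs" "all_cells qs = M2" "\<forall>C. (C, None) \<in> set qs \<longrightarrow> card C = m"
    "length (filter (\<lambda>a. snd a = None) qs) = critical_count t" by (auto simp: M2_def)
  then show ?case
    using ps by (intro exI[of _ "ps @ qs"]) (auto simp: morse_seq_append all_cells_append M)
next
  case (Split u v s t)
  let ?R = "\<lambda>x y. R x y \<or> x = u \<and> y = v \<or> x = v \<and> y = u"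
    and ?S2 = "filter (\<lambda>x. x \<noteq> u \<and> x \<noteq> v \<and> \<not> R u x \<and> \<not> R v x) S"
  have uv: "u \<in> set S" "v \<in> set S" "u \<noteq> v" "\<not> R u v" "u \<notin> A" "v \<notin> A" using Split.prems by auto
  define M1 M2 where "M1 = ind_cells A ?R (set S)" and "M2 = ind_cells (insert u (insert v A)) R (set ?S2)"
  have e1: "set ?S2 = {x \<in> set S. x \<noteq> u \<and> x \<noteq> v \<and> \<not> R u x \<and> \<not> R v x}" by auto
  have M: "ind_cells A R (set S) = M1 \<union> M2"
    using ind_cells_Split[OF Split.prems(2,3,6) uv(1-4)] unfolding M1_def M2_def e1 by simp
  have vM1: "\<not> {u, v} \<subseteq> \<sigma>" if "\<sigma> \<in> M1" for \<sigma>
    using that uv by (auto simp: M1_def ind_cells_def independent_in_def)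
  have vM2: "{u, v} \<subseteq> \<sigma>" if "\<sigma> \<in> M2" for \<sigma> using that by (auto simp: M2_def ind_cells_def)
  have c1: "face_closed (K \<union> M1)"
    using Split.prems(8)[unfolded M] Split.prems(7)
    by (rule face_closed_Un_part) (use vM1 vM2 in blast)
  have "\<exists>ps. morse_seq K ps \<and> all_cells ps = ind_cells A ?R (set S) \<and>
    (\<forall>C. (C, None) \<in> set ps \<longrightarrow> card C = m) \<and> length (filter (\<lambda>a. snd a = None) ps) = critical_count s"
  proof (rule Split.IH(1))
    show "symp ?R" using Split.prems(2) by (auto simp: symp_def)
    show "face_closed (K \<union> ind_cells A ?R (set S))" using c1 by (simp add: M1_def)
    show "K \<inter> ind_cells A ?R (set S) = {}" using Split.prems(9) unfolding M M1_def[symmetric] by blast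
  qed (use Split.prems in auto)
  then obtain ps where ps: "morse_seq K ps" "all_cells ps = M1" "\<forall>C. (C, None) \<in> set ps \<longrightarrow> card C = m"
    "length (filter (\<lambda>a. snd a = None) ps) = critical_count s" by (auto simp: M1_def)
  have "\<exists>qs. morse_seq (K \<union> M1) qs \<and> all_cells qs = ind_cells (insert u (insert v A)) R (set ?S2) \<and>
    (\<forall>C. (C, None) \<in> set qs \<longrightarrow> card C = m) \<and> length (filter (\<lambda>a. snd a = None) qs) = critical_count t"
  proof (rule Split.IH(2))
    show "(K \<union> M1) \<inter> ind_cells (insert u (insert v A)) R (set ?S2) = {}"
      using Split.prems(9) vM1 vM2 unfolding M M2_def[symmetric] by blast
    show "face_closed (K \<union> M1 \<union> ind_cells (insert u (insert v A)) R (set ?S2))"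
      using Split.prems(8) unfolding M M2_def[symmetric] by (simp add: Un_assoc)
  qed (use Split.prems uv c1 in auto)
  then obtain qs where "morse_seq (K \<union> M1) qs" "all_cells qs = M2" "\<forall>C. (C, None) \<in> set qs \<longrightarrow> card C = m"
    "length (filter (\<lambda>a. snd a = None) qs) = critical_count t" by (auto simp: M2_def)
  then show ?case
    using ps by (intro exI[of _ "ps @ qs"]) (auto simp: morse_seq_append all_cells_append M)
qed

theorem (in basis_vertices) valid_tree_wedge_of_spheres:
  assumes t: "valid_tree t R (Suc m) S" and R: "symp R" "\<And>x. \<not> R x x" and S: "set S \<subseteq> V"
    and n: "critical_count t = n" "n > 0"
  shows "top_of_set (realize p {\<sigma>. \<sigma> \<subseteq> set S \<and> independent_in R \<sigma>})
    homotopy_equivalent_space wedge_of_spheres n m"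
proof -
  have eq: "ind_cells {} R (set S) = {\<sigma>. \<sigma> \<subseteq> set S \<and> independent_in R \<sigma>}"
    by (auto simp: ind_cells_def)
  have "face_closed (ind_cells {} R (set S))"
    unfolding eq face_closed_def by (fast intro: independent_in_mono)
  then have "\<exists>ps. morse_seq {} ps \<and> all_cells ps = ind_cells {} R (set S) \<and>
    (\<forall>C. (C, None) \<in> set ps \<longrightarrow> card C = Suc m) \<and> length (filter (\<lambda>a. snd a = None) ps) = critical_count t"
    by (intro valid_tree_morse_seq[OF t R]) (simp_all add: face_closed_def[of "{}"])
  then obtain ps where ps: "morse_seq {} ps" "all_cells ps = {\<sigma>. \<sigma> \<subseteq> set S \<and> independent_in R \<sigma>}"
    "\<And>C. (C, None) \<in> set ps \<Longrightarrow> card C = Suc m" "length (filter (\<lambda>a. snd a = None) ps) = n"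
    unfolding eq n(1) by blast
  have "all_cells ps \<subseteq> Pow V" using S by (auto simp: ps(2))
  then show ?thesis
    using morse_seq_wedge_of_spheres[OF ps(1) _ ps(3,4) n(2)] by (simp add: ps(2))
qed

section \<open>The Hasse diagrams of the tetrahedron and its boundary\<close>

text \<open>A coordinate function is turned into the corresponding combination of basis vectors and
  recovered by inner products. Outside \<open>V\<close> the inverse takes the value 0, as the
  support of a function in the realization is a member of \<open>K\<close> and so lies in
  \<open>V\<close>.\<close>

lemma (in basis_vertices) geometric_realization_homeomorphic:
  assumes K: "K \<subseteq> Pow V" and faces: "\<And>\<sigma> \<tau>. \<sigma> \<in> K \<Longrightarrow> \<tau> \<subseteq> \<sigma> \<Longrightarrow> \<tau> \<noteq> {} \<Longrightarrow> \<tau> \<in> K"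
  shows "geometric_realization K homeomorphic_space top_of_set (realize p K)"
proof -
  define G where "G = {f :: 'v \<Rightarrow> real. (\<forall>v. 0 \<le> f v) \<and> {v. f v \<noteq> 0} \<in> K \<and> finite {v. f v \<noteq> 0}
         \<and> sum f {v. f v \<noteq> 0} = 1}"
  have G: "geometric_realization K = top_of_set G"
    by (simp add: geometric_realization_def G_def euclidean_product_topology)
  define \<Phi> where "\<Phi> = (\<lambda>f. \<Sum>v\<in>V. f v *\<^sub>R p v)"
  define \<Psi> where "\<Psi> = (\<lambda>x v. if v \<in> V then x \<bullet> p v else 0)"
  have \<Phi>: "\<Phi> f \<in> realize p K \<and> \<Psi> (\<Phi> f) = f" if f: "f \<in> G" for f
  proof
    let ?\<sigma> = "{v. f v \<noteq> 0}"
    have \<sigma>: "?\<sigma> \<in> K" "?\<sigma> \<subseteq> V" "finite ?\<sigma>" "sum f ?\<sigma> = 1" "\<And>v. 0 \<le> f v"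
      using f K by (auto simp: G_def)
    have "\<Phi> f = (\<Sum>v\<in>?\<sigma>. f v *\<^sub>R p v)"
      unfolding \<Phi>_def using finite_V \<sigma>(2) by (intro sum.mono_neutral_right) auto
    also have "\<dots> \<in> convex hull (p ` ?\<sigma>)"
      using \<sigma> by (intro convex_sum) (auto intro: hull_inc)
    finally show "\<Phi> f \<in> realize p K" using \<sigma>(1) by (auto simp: realize_def)
    show "\<Psi> (\<Phi> f) = f"
    proof
      fix v
      show "\<Psi> (\<Phi> f) v = f v"
      proof (cases "v \<in> V")
        case True
        have "\<Phi> f \<bullet> p v = (\<Sum>w\<in>V. if w = v then f w else 0)"
          unfolding \<Phi>_def inner_sum_left using True by (intro sum.cong) (auto simp: inner_p)
        then show ?thesis using True finite_V by (simp add: \<Psi>_def)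
      qed (use \<sigma>(2) in \<open>auto simp: \<Psi>_def\<close>)
    qed
  qed
  have \<Psi>: "\<Psi> x \<in> G \<and> \<Phi> (\<Psi> x) = x" if x: "x \<in> realize p K" for x
  proof
    obtain \<sigma> where \<sigma>: "\<sigma> \<in> K" "\<sigma> \<subseteq> V" "x \<in> convex hull (p ` \<sigma>)"
      using x K by (auto simp: realize_def)
    have fin: "finite \<sigma>" using \<sigma>(2) finite_V finite_subset by blast
    have h: "\<And>v. v \<in> \<sigma> \<Longrightarrow> 0 \<le> x \<bullet> p v" "(\<Sum>v\<in>\<sigma>. x \<bullet> p v) = 1" "(\<Sum>v\<in>\<sigma>. (x \<bullet> p v) *\<^sub>R p v) = x"
      using \<sigma>(3) hull_iff[OF \<sigma>(2)] by auto
    have out: "\<Psi> x v = 0" if "v \<notin> \<sigma>" for v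
      using hull_outside[OF \<sigma>(2,3)] that by (auto simp: \<Psi>_def)
    have on: "\<Psi> x v = x \<bullet> p v" if "v \<in> \<sigma>" for v
      using \<sigma>(2) that by (auto simp: \<Psi>_def)
    let ?\<tau> = "{v. \<Psi> x v \<noteq> 0}"
    have \<tau>: "?\<tau> \<subseteq> \<sigma>" using out by auto
    have sum1: "sum (\<Psi> x) ?\<tau> = 1"
    proof -
      have "sum (\<Psi> x) ?\<tau> = sum (\<Psi> x) \<sigma>" using fin \<tau> by (intro sum.mono_neutral_left) auto
      also have "\<dots> = 1" using h(2) on by simp
      finally show ?thesis .
    qed
    \<comment> \<open>The coordinates sum to 1, so the support is nonempty; closure of
      \<open>K\<close> under nonempty faces then suffices.\<close>
    then have "?\<tau> \<noteq> {}" by (metis sum.empty zero_neq_one)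
    then have "?\<tau> \<in> K" using faces[OF \<sigma>(1) \<tau>] by simp
    moreover have "0 \<le> \<Psi> x v" for v using h(1) on out by (cases "v \<in> \<sigma>") auto
    moreover have "finite ?\<tau>" using \<tau> fin finite_subset by blast
    ultimately show "\<Psi> x \<in> G" using sum1 by (simp add: G_def)
    have "\<Phi> (\<Psi> x) = (\<Sum>v\<in>\<sigma>. \<Psi> x v *\<^sub>R p v)"
      unfolding \<Phi>_def using finite_V \<sigma>(2) out by (intro sum.mono_neutral_right) auto
    then show "\<Phi> (\<Psi> x) = x" using h(3) on by simp
  qed
  have "continuous_on G \<Phi>"
    unfolding \<Phi>_def
    by (intro continuous_intros continuous_on_product_then_coordinatewise)
  moreover have "continuous_on (realize p K) \<Psi>"
    unfolding \<Psi>_def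
  proof (rule continuous_on_coordinatewise_then_product)
    show "continuous_on (realize p K) (\<lambda>x. if v \<in> V then x \<bullet> p v else 0)" for v
      by (cases "v \<in> V") (auto intro!: continuous_intros)
  qed
  ultimately show ?thesis
    unfolding G homeomorphic_space_def homeomorphic_maps_def
    using \<Phi> \<Psi> by (intro exI[of _ \<Phi>] exI[of _ \<Psi>]) auto
qed

text \<open>For evaluation, a face of the tetrahedron is encoded as a number below 16, its bits being the
  vertices. The proper nonempty faces are then the numbers strictly between 0 and 15.\<close>

definition bits :: "nat \<Rightarrow> nat set" where
  "bits a = {i. bit a i}"

definition bits_edge :: "nat \<times> nat \<Rightarrow> nat set \<times> nat set" where
  "bits_edge e = (bits (fst e), bits (snd e))"

text \<open>Starting at 1 omits the empty face. The bound 16 gives the whole tetrahedron, while 15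
  drops the code of the full face and leaves the boundary.\<close>

definition hasse_codes :: "nat \<Rightarrow> (nat \<times> nat) list" where
  "hasse_codes m = [(a, set_bit i a). a \<leftarrow> [1..<m], i \<leftarrow> [0..<4], \<not> bit a i \<and> set_bit i a < m]"

definition share_node :: "nat \<times> nat \<Rightarrow> nat \<times> nat \<Rightarrow> bool" where
  "share_node x y \<longleftrightarrow> x \<noteq> y \<and> (fst x = fst y \<or> snd x = snd y \<or> fst x = snd y \<or> snd x = fst y)"

lemma bits_inject [simp]: "bits a = bits b \<longleftrightarrow> a = b"
  by (auto simp: bits_def bit_eq_iff set_eq_iff)

lemma inj_bits: "inj bits"
  by (rule injI) simp

lemma bits_edge_inject [simp]: "bits_edge x = bits_edge y \<longleftrightarrow> x = y"
  by (auto simp: bits_edge_def prod_eq_iff)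

lemma bits_set_bit: "bits (set_bit i a) = insert i (bits a)"
  by (auto simp: bits_def bit_set_bit_iff)

lemma bits_subset: "a < 16 \<Longrightarrow> bits a \<subseteq> {0..3}"
proof
  fix i assume "a < 16" "i \<in> bits a"
  then have "take_bit 4 a = a" "bit a i" by (simp_all add: take_bit_nat_eq_self_iff bits_def)
  then have "bit (take_bit 4 a) i" by simp
  then show "i \<in> {0..3}" by (simp add: bit_take_bit_iff)
qed

text \<open>Sixteen distinct codes land in a power set with sixteen members, so none is
  missed.\<close>

lemma bits_image: "bits ` {..<16} = Pow {0..3}"
proof (rule card_subset_eq)
  show "bits ` {..<16} \<subseteq> Pow {0..3}" using bits_subset by auto
  show "card (bits ` {..<16}) = card (Pow {0..3::nat})"
    by (simp add: card_image inj_on_def card_Pow)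
qed simp

lemma bits_0 [simp]: "bits 0 = {}" by (simp add: bits_def)

lemma bits_15: "bits 15 = {0..3}"
proof -
  obtain a where a: "a < 16" "bits a = {0..3}" using bits_image by (metis PowI imageE lessThan_iff order_refl)
  have "a = 15"
  proof -
    have "\<forall>i<4. bit a i" using a(2) by (auto simp: bits_def set_eq_iff)
    then have "take_bit 4 a = mask 4"
      by (intro bit_eqI) (auto simp: bit_take_bit_iff bit_mask_iff)
    moreover have "take_bit 4 a = a" using a(1) by (simp add: take_bit_nat_eq_self_iff)
    ultimately show ?thesis by (simp add: mask_eq_exp_minus_1)
  qed
  then show ?thesis using a by simp
qed

lemma simplex3_bits: "simplex3 = bits ` {0<..<16}"
proof -
  have "{0<..<16} = {..<16} - {0::nat}" by auto
  then have "bits ` {0<..<16} = Pow {0..3} - {{}}"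
    using bits_image by (simp add: image_set_diff[OF inj_bits])
  then show ?thesis by (auto simp: simplex3_def)
qed

lemma boundary_simplex3_bits: "boundary_simplex3 = bits ` {0<..<15}"
proof -
  have "{0<..<15} = {0<..<16} - {15::nat}" by auto
  then have "bits ` {0<..<15} = simplex3 - {{0..3}}"
    by (simp add: simplex3_bits image_set_diff[OF inj_bits] bits_15)
  then show ?thesis by (auto simp: simplex3_def boundary_simplex3_def)
qed

lemma hasse_edges_bits:
  assumes "m \<le> 16"
  shows "hasse_edges (bits ` {0<..<m}) = bits_edge ` set (hasse_codes m)"
proof (intro set_eqI iffI)
  fix e assume "e \<in> hasse_edges (bits ` {0<..<m})"
  then obtain \<sigma> \<tau> where "e = (\<sigma>, \<tau>)" "\<sigma> \<in> bits ` {0<..<m}" "\<tau> \<in> bits ` {0<..<m}" "\<sigma> \<subset> \<tau>"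
    "card \<tau> = card \<sigma> + 1" unfolding hasse_edges_def by blast
  then obtain a b where e: "e = (bits a, bits b)" "a \<in> {0<..<m}" "b \<in> {0<..<m}" "bits a \<subset> bits b"
    "card (bits b) = card (bits a) + 1" by blast
  have fin: "finite (bits b)" using bits_subset[of b] assms e(3) finite_subset by auto
  obtain i where i: "i \<in> bits b" "i \<notin> bits a" using e(4) by blast
  have "finite (bits a)" using fin e(4) finite_subset by blast
  \<comment> \<open>The cardinalities differ by one, so a single new vertex already exhausts the
    larger face.\<close>
  then have "insert i (bits a) = bits b"
    using fin i e(4,5) by (intro card_subset_eq) auto
  then have b: "set_bit i a = b" using bits_set_bit by (metis bits_inject)
  moreover have "i < 4" using bits_subset[of b] assms e(3) i by auto
  ultimately have "(a, b) \<in> set (hasse_codes m)"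
    using e(2,3) i(2) by (force simp: hasse_codes_def bits_def)
  then show "e \<in> bits_edge ` set (hasse_codes m)" using e(1) by (force simp: bits_edge_def)
next
  fix e assume "e \<in> bits_edge ` set (hasse_codes m)"
  then obtain a i where ai: "e = (bits a, bits (set_bit i a))" "0 < a" "a < m" "\<not> bit a i" "set_bit i a < m"
    by (auto simp: hasse_codes_def bits_edge_def split: if_splits)
  have "i \<notin> bits a" using ai(4) by (simp add: bits_def)
  moreover have "finite (bits a)" using bits_subset[of a] assms ai(3) finite_subset by auto
  moreover have "0 < set_bit i a" using ai(2) by (simp add: set_bit_eq)
  moreover have "insert i (bits a) \<in> bits ` {0<..<m}"
    unfolding bits_set_bit[symmetric] using ai(5) \<open>0 < set_bit i a\<close> by simp
  ultimately show "e \<in> hasse_edges (bits ` {0<..<m})"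
    using ai by (auto simp: hasse_edges_def bits_set_bit)
qed

section \<open>Matchings as independent sets of codes\<close>

lemma is_matching_bits:
  "is_matching (bits_edge ` \<sigma>) \<longleftrightarrow> independent_in share_node \<sigma>"
proof -
  have "{fst (bits_edge x), snd (bits_edge x)} \<inter> {fst (bits_edge y), snd (bits_edge y)} = {} \<longleftrightarrow>
      \<not> (fst x = fst y \<or> snd x = snd y \<or> fst x = snd y \<or> snd x = fst y)" for x y
    by (auto simp: bits_edge_def)
  then show ?thesis
    unfolding is_matching_def independent_in_def share_node_def by (simp only: ball_simps bits_edge_inject) blast
qed

lemma GM_bits:
  assumes "m \<le> 16"
  shows "GM (bits ` {0<..<m}) =
    (`) bits_edge ` ({\<sigma>. \<sigma> \<subseteq> set (hasse_codes m) \<and> independent_in share_node \<sigma>} - {{}})"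
proof (intro set_eqI iffI)
  fix M assume "M \<in> GM (bits ` {0<..<m})"
  then have M: "M \<noteq> {}" "M \<subseteq> bits_edge ` set (hasse_codes m)" "is_matching M"
    by (auto simp: GM_def hasse_edges_bits[OF assms])
  then obtain \<sigma> where "M = bits_edge ` \<sigma>" "\<sigma> \<subseteq> set (hasse_codes m)" by (meson subset_imageE)
  then show "M \<in> (`) bits_edge ` ({\<sigma>. \<sigma> \<subseteq> set (hasse_codes m) \<and> independent_in share_node \<sigma>} - {{}})"
    using M is_matching_bits by auto
qed (auto simp: GM_def hasse_edges_bits[OF assms] is_matching_bits)

text \<open>One basis vector is spent on each Hasse edge. The tetrahedron has 4*3 + 6*2 + 4*1 = 28
  of them and its boundary 24, so 28 real dimensions serve both.\<close>

lemma GM_wedge_of_spheres: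
  assumes m: "m \<le> 16" and t: "valid_tree t share_node (Suc d) (hasse_codes m)"
    and n: "critical_count t = n" "n > 0" and len: "length (hasse_codes m) \<le> 28"
  shows "geometric_realization (GM (bits ` {0<..<m})) homotopy_equivalent_space wedge_of_spheres n d"
proof -
  define V where "V = set (hasse_codes m)"
  define I where "I = {\<sigma>. \<sigma> \<subseteq> V \<and> independent_in share_node \<sigma>}"
  have "card V \<le> card (Basis :: (real ^ 28) set)"
    using len card_length[of "hasse_codes m"] by (simp add: V_def)
  then obtain p :: "nat \<times> nat \<Rightarrow> real ^ 28" where p: "p ` V \<subseteq> Basis" "inj_on p V"
    using card_le_inj[of V "Basis :: (real ^ 28) set"] by (auto simp: V_def)
  then interpret basis_vertices V p by unfold_locales (auto simp: V_def)
  \<comment> \<open>\<open>p'\<close> puts a Hasse edge where \<open>p\<close> puts its code. The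
    complex of matchings and the complex of independent sets of codes then have literally the same
    realization.\<close>
  define p' where "p' = p \<circ> the_inv bits_edge"
  have inj: "inj bits_edge" by (rule injI) simp
  have p'_image: "p' ` (bits_edge ` \<sigma>) = p ` \<sigma>" for \<sigma>
    by (simp add: p'_def image_image the_inv_f_f[OF inj])
  interpret E: basis_vertices "bits_edge ` V" p'
  proof
    show "inj_on p' (bits_edge ` V)"
      using p(2) by (auto simp: inj_on_def p'_def the_inv_f_f[OF inj])
  qed (use p p'_image in \<open>auto simp: V_def\<close>)
  have GM: "GM (bits ` {0<..<m}) = (`) bits_edge ` (I - {{}})"
    using GM_bits[OF m] by (simp add: I_def V_def)
  have "realize p' (GM (bits ` {0<..<m})) = realize p (I - {{}})"
    by (simp add: realize_def GM p'_image)
  also have "\<dots> = realize p I" by (auto simp: realize_def)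
  finally have eq: "realize p' (GM (bits ` {0<..<m})) = realize p I" .
  have "geometric_realization (GM (bits ` {0<..<m})) homeomorphic_space
      top_of_set (realize p' (GM (bits ` {0<..<m})))"
  proof (rule E.geometric_realization_homeomorphic)
    show "GM (bits ` {0<..<m}) \<subseteq> Pow (bits_edge ` V)" by (auto simp: GM I_def)
    show "\<tau> \<in> GM (bits ` {0<..<m})" if "\<sigma> \<in> GM (bits ` {0<..<m})" "\<tau> \<subseteq> \<sigma>" "\<tau> \<noteq> {}" for \<sigma> \<tau>
      using that unfolding GM_def is_matching_def by blast
  qed
  then have "geometric_realization (GM (bits ` {0<..<m})) homotopy_equivalent_space top_of_set (realize p I)"
    unfolding eq by (rule homeomorphic_imp_homotopy_equivalent_space)
  moreover have "top_of_set (realize p I) homotopy_equivalent_space wedge_of_spheres n d"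
    unfolding I_def V_def
  proof (rule valid_tree_wedge_of_spheres[OF t _ _ _ n])
    show "symp share_node" by (auto simp: symp_def share_node_def)
  qed (auto simp: share_node_def V_def)
  ultimately show ?thesis by (rule homotopy_eqv_trans)
qed

section \<open>The two matching trees\<close>

text \<open>These certificates were found by a computer search; only their validity matters.\<close>

definition tree15 :: "(nat \<times> nat) mtree" where
  "tree15 =
   (Branch (1,3) (Branch (2,6) (Branch (4,5) (Branch (8,9) (Branch (10,11) (Branch (12,13) (Branch
   (3,7) (Branch (10,14) (Branch (1,9) (Branch (5,7) (Branch (9,13) (Branch (2,3) (Branch (8,12)
   (Branch (6,14) (Branch (4,12) (Pivot (12,14)) (Pivot (6,7))) (Pivot (4,12))) (Pivot (2,10)))
   (Pivot (9,11))) (Pivot (1,5))) (Branch (12,14) (Branch (3,11) (Branch (8,10) (Branch (4,6) (Pivot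
   (6,14)) (Pivot (8,12))) (Pivot (2,3))) (Pivot (9,13))) (Pivot (4,6)))) (Branch (2,10) (Branch
   (4,12) (Branch (12,14) (Branch (6,7) (Branch (2,3) (Pivot (3,11)) (Branch (4,6) (Pivot (6,14))
   (Branch (8,10) (Pivot (8,12)) (Branch (5,7) (Pivot (5,13)) Crit)))) (Pivot (5,13))) (Pivot
   (8,10))) (Pivot (8,10))) (Pivot (3,11)))) (Branch (9,11) (Branch (5,13) (Branch (4,6) (Branch
   (1,5) (Branch (1,9) (Pivot (9,13)) (Branch (2,3) (Pivot (3,11)) (Branch (4,12) (Pivot (8,12))
   (Branch (5,7) (Pivot (6,7)) Crit)))) (Pivot (9,13))) (Pivot (8,12))) (Pivot (1,9))) (Pivot
   (2,3)))) (Branch (9,13) (Branch (12,14) (Branch (1,9) (Pivot (9,11)) (Pivot (5,13))) (Pivot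
   (4,6))) (Pivot (1,5)))) (Branch (3,7) (Branch (2,10) (Branch (9,11) (Branch (5,7) (Branch (6,14)
   (Branch (1,5) (Pivot (1,9)) (Branch (2,3) (Pivot (3,11)) (Branch (4,6) (Pivot (6,7)) (Branch
   (8,10) (Pivot (10,14)) Crit)))) (Pivot (8,10))) (Pivot (1,9))) (Pivot (2,3))) (Branch (1,9)
   (Branch (6,7) (Branch (1,5) (Pivot (5,7)) (Branch (4,6) (Pivot (6,14)) (Branch (3,11) (Pivot
   (9,11)) Crit))) (Pivot (1,5))) (Pivot (3,11)))) (Branch (9,11) (Branch (10,14) (Branch (1,5)
   (Pivot (1,9)) (Branch (2,10) (Pivot (8,10)) (Branch (4,6) (Pivot (6,14)) Crit))) (Pivot (4,6)))
   (Pivot (1,5))))) (Branch (5,13) (Branch (5,7) (Branch (9,13) (Branch (6,7) (Branch (12,14) (Branch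
   (4,12) (Branch (1,5) (Pivot (1,9)) (Branch (2,3) (Pivot (3,7)) (Branch (4,6) (Pivot (6,14))
   (Branch (8,12) (Pivot (12,13)) Crit)))) (Pivot (6,14))) (Pivot (4,6))) (Pivot (2,3))) (Pivot
   (1,5))) (Pivot (2,3))) (Pivot (1,9)))) (Branch (3,7) (Branch (10,11) (Branch (2,10) (Branch (6,14)
   (Branch (4,12) (Branch (5,7) (Branch (12,13) (Branch (1,5) (Pivot (5,13)) (Branch (2,3) (Pivot
   (3,11)) (Branch (4,6) (Pivot (6,7)) (Branch (10,14) (Pivot (12,14)) Crit)))) (Pivot (1,5))) (Pivot
   (4,6))) (Pivot (10,14))) (Branch (5,13) (Branch (1,5) (Pivot (5,7)) (Branch (2,3) (Pivot (3,11))
   (Branch (4,12) (Pivot (12,13)) Crit))) (Pivot (4,12)))) (Pivot (3,11))) (Pivot (2,3))) (Branch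
   (12,13) (Branch (12,14) (Branch (6,14) (Branch (2,10) (Branch (1,5) (Pivot (5,13)) (Branch (4,6)
   (Pivot (4,12)) (Branch (10,11) (Pivot (10,14)) Crit))) (Branch (1,5) (Pivot (5,13)) (Branch (4,6)
   (Pivot (4,12)) Crit))) (Pivot (4,12))) (Pivot (4,6))) (Pivot (1,5))))) (Branch (8,9) (Branch
   (10,11) (Branch (10,14) (Branch (2,3) (Branch (8,12) (Branch (9,11) (Branch (12,13) (Branch (6,7)
   (Branch (1,9) (Pivot (9,13)) (Branch (2,10) (Pivot (8,10)) (Branch (3,7) (Pivot (3,11)) (Branch
   (6,14) (Pivot (12,14)) Crit)))) (Pivot (3,11))) (Pivot (1,9))) (Branch (6,14) (Branch (2,10)
   (Pivot (8,10)) (Branch (3,7) (Pivot (6,7)) (Branch (12,13) (Pivot (12,14)) Crit))) (Pivot (3,7))))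
   (Pivot (2,10))) (Branch (12,13) (Branch (12,14) (Branch (1,9) (Branch (8,10) (Pivot (8,12))
   (Branch (9,11) (Pivot (9,13)) (Branch (6,7) (Pivot (6,14)) Crit))) (Branch (8,10) (Pivot (8,12))
   (Branch (6,7) (Pivot (6,14)) Crit))) (Pivot (8,10))) (Pivot (8,10)))) (Branch (9,13) (Branch
   (3,11) (Branch (6,7) (Branch (1,9) (Pivot (9,11)) (Branch (2,3) (Pivot (3,7)) (Branch (8,12)
   (Pivot (12,13)) Crit))) (Pivot (2,3))) (Pivot (1,9))) (Pivot (8,12)))) (Branch (12,13) (Branch
   (6,7) (Branch (6,14) (Branch (1,9) (Pivot (9,13)) (Branch (2,3) (Pivot (3,7)) (Branch (8,12)
   (Pivot (12,14)) Crit))) (Pivot (8,12))) (Pivot (2,3))) (Pivot (1,9)))) (Branch (6,14) (Branch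
   (2,3) (Branch (3,11) (Branch (10,14) (Branch (2,10) (Pivot (10,11)) (Branch (3,7) (Pivot (6,7))
   (Branch (12,13) (Pivot (12,14)) Crit))) (Pivot (12,13))) (Pivot (6,7))) (Pivot (6,7))) (Pivot
   (12,13))))) (Branch (8,9) (Branch (5,13) (Branch (4,12) (Branch (9,11) (Branch (1,5) (Branch
   (12,13) (Branch (3,7) (Branch (10,14) (Branch (8,10) (Branch (1,9) (Pivot (9,13)) (Branch (4,5)
   (Pivot (5,7)) (Branch (8,12) (Pivot (12,14)) (Branch (3,11) (Pivot (10,11)) Crit)))) (Pivot
   (3,11))) (Pivot (8,12))) (Pivot (4,5))) (Pivot (1,9))) (Branch (10,11) (Branch (12,14) (Branch
   (8,12) (Branch (8,10) (Pivot (10,14)) (Branch (3,7) (Pivot (3,11)) (Branch (9,13) (Pivot (12,13))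
   Crit))) (Pivot (9,13))) (Pivot (8,10))) (Pivot (3,7)))) (Branch (12,14) (Branch (1,5) (Branch
   (3,7) (Branch (8,12) (Pivot (12,13)) (Pivot (10,14))) (Pivot (4,5))) (Pivot (3,7))) (Pivot
   (8,10)))) (Branch (9,11) (Branch (1,5) (Branch (3,11) (Branch (8,10) (Branch (1,9) (Pivot (9,13))
   (Branch (3,7) (Pivot (5,7)) (Branch (10,11) (Pivot (10,14)) Crit))) (Branch (1,9) (Pivot (9,13))
   (Branch (3,7) (Pivot (5,7)) Crit))) (Pivot (5,7))) (Pivot (9,13))) (Branch (3,7) (Branch (1,5)
   (Pivot (5,7)) (Branch (8,10) (Pivot (10,14)) Crit)) (Pivot (1,5))))) (Branch (3,11) (Pivot (3,7))
   (Pivot (1,9)))) (Branch (4,5) (Branch (5,7) (Branch (12,13) (Branch (10,14) (Branch (10,11)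
   (Branch (1,5) (Pivot (5,13)) (Branch (4,12) (Pivot (12,14)) (Branch (3,7) (Pivot (3,11)) Crit)))
   (Pivot (3,7))) (Pivot (4,12))) (Pivot (1,5))) (Branch (10,14) (Branch (4,12) (Branch (3,11) (Pivot
   (10,11)) (Branch (12,13) (Pivot (12,14)) Crit)) (Branch (3,11) (Pivot (10,11)) Crit)) (Pivot
   (3,11)))) (Branch (10,11) (Branch (12,13) (Branch (3,7) (Pivot (3,11)) (Branch (10,14) (Pivot
   (12,14)) Crit)) (Pivot (10,14))) (Pivot (3,7)))))) (Branch (4,6) (Branch (8,10) (Branch (12,13)
   (Branch (6,14) (Branch (2,10) (Branch (5,7) (Branch (4,12) (Branch (9,13) (Branch (8,9) (Branch
   (10,14) (Branch (2,6) (Pivot (6,7)) (Branch (4,5) (Pivot (5,13)) (Branch (8,12) (Pivot (12,14))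
   (Branch (9,11) (Pivot (10,11)) Crit)))) (Pivot (8,12))) (Branch (12,14) (Branch (2,6) (Pivot
   (6,7)) (Branch (4,5) (Pivot (5,13)) (Branch (10,11) (Pivot (10,14)) Crit))) (Pivot (10,11))))
   (Pivot (4,5))) (Branch (8,9) (Branch (9,11) (Branch (2,6) (Pivot (6,7)) (Branch (5,13) (Pivot
   (9,13)) (Branch (10,11) (Pivot (10,14)) Crit))) (Pivot (5,13))) (Pivot (5,13)))) (Pivot (2,6)))
   (Branch (4,5) (Branch (5,13) (Branch (8,9) (Branch (4,12) (Branch (8,12) (Pivot (12,14)) (Branch
   (5,7) (Pivot (6,7)) (Branch (9,11) (Pivot (9,13)) Crit))) (Branch (5,7) (Pivot (6,7)) (Branch
   (9,11) (Pivot (9,13)) Crit))) (Branch (4,12) (Pivot (12,14)) (Branch (5,7) (Pivot (6,7)) Crit)))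
   (Pivot (6,7))) (Pivot (6,7)))) (Branch (9,11) (Branch (4,5) (Branch (8,9) (Branch (9,13) (Branch
   (2,10) (Pivot (10,11)) (Branch (4,12) (Pivot (8,12)) (Branch (5,7) (Pivot (5,13)) Crit))) (Pivot
   (5,7))) (Pivot (4,12))) (Branch (9,13) (Branch (2,10) (Pivot (10,11)) (Branch (8,9) (Pivot (8,12))
   Crit)) (Pivot (8,12)))) (Pivot (2,10)))) (Branch (6,7) (Branch (10,14) (Branch (10,11) (Branch
   (6,14) (Branch (2,6) (Pivot (2,10)) (Branch (4,5) (Pivot (5,7)) (Branch (8,9) (Pivot (9,11))
   Crit))) (Pivot (2,10))) (Pivot (8,9))) (Pivot (2,6))) (Pivot (4,5)))) (Branch (5,13) (Branch
   (12,13) (Branch (6,7) (Branch (12,14) (Branch (5,7) (Branch (2,6) (Pivot (6,14)) (Branch (4,5)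
   (Pivot (4,12)) (Branch (9,11) (Pivot (9,13)) Crit))) (Pivot (4,12))) (Pivot (2,6))) (Branch
   (12,14) (Branch (4,5) (Pivot (4,12)) (Branch (9,11) (Pivot (9,13)) Crit)) (Pivot (4,5)))) (Pivot
   (9,11))) (Pivot (9,11)))) (Branch (9,13) (Branch (12,13) (Branch (8,10) (Branch (10,11) (Branch
   (12,14) (Branch (9,11) (Branch (2,10) (Pivot (10,14)) (Branch (8,9) (Pivot (8,12)) (Branch (5,7)
   (Pivot (5,13)) Crit))) (Pivot (8,12))) (Pivot (2,10))) (Branch (12,14) (Branch (8,9) (Pivot
   (8,12)) (Branch (5,7) (Pivot (5,13)) Crit)) (Pivot (8,9)))) (Pivot (9,11))) (Pivot (5,7))) (Pivot
   (5,7)))))"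

definition tree16 :: "(nat \<times> nat) mtree" where
  "tree16 =
   (Branch (3,7) (Branch (5,13) (Branch (9,11) (Branch (6,14) (Branch (2,10) (Branch (4,12) (Branch
   (7,15) (Branch (1,3) (Branch (8,9) (Branch (10,11) (Branch (12,14) (Branch (13,15) (Branch (1,5)
   (Branch (12,13) (Branch (6,7) (Branch (10,14) (Branch (4,6) (Branch (3,11) (Branch (1,9) (Pivot
   (9,13)) (Branch (2,3) (Pivot (2,6)) (Branch (4,5) (Pivot (5,7)) (Branch (8,10) (Pivot (8,12))
   (Branch (11,15) (Pivot (14,15)) Crit))))) (Pivot (2,6))) (Pivot (5,7))) (Pivot (8,12))) (Pivot
   (4,5))) (Pivot (1,9))) (Branch (8,12) (Branch (14,15) (Branch (2,3) (Branch (2,6) (Branch (4,6)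
   (Pivot (6,7)) (Branch (8,10) (Pivot (10,14)) (Branch (3,11) (Pivot (11,15)) (Branch (9,13) (Pivot
   (12,13)) Crit)))) (Branch (8,10) (Pivot (10,14)) (Branch (3,11) (Pivot (11,15)) (Branch (9,13)
   (Pivot (12,13)) Crit)))) (Pivot (11,15))) (Pivot (8,10))) (Pivot (9,13)))) (Branch (4,5) (Branch
   (5,7) (Branch (10,14) (Branch (2,6) (Branch (1,5) (Pivot (1,9)) (Branch (2,3) (Pivot (3,11))
   (Branch (4,6) (Pivot (6,7)) (Branch (8,10) (Pivot (8,12)) Crit)))) (Pivot (3,11))) (Pivot (8,12)))
   (Pivot (1,9))) (Pivot (1,9)))) (Pivot (8,10))) (Branch (4,6) (Branch (6,7) (Branch (12,13) (Branch
   (14,15) (Branch (1,9) (Branch (1,5) (Branch (2,3) (Pivot (2,6)) (Branch (4,5) (Pivot (5,7))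
   (Branch (8,12) (Pivot (12,14)) (Branch (9,13) (Pivot (13,15)) Crit)))) (Branch (2,3) (Pivot (2,6))
   (Branch (8,12) (Pivot (12,14)) (Branch (9,13) (Pivot (13,15)) Crit)))) (Pivot (13,15))) (Pivot
   (8,12))) (Pivot (14,15))) (Pivot (2,3))) (Pivot (2,3)))) (Branch (14,15) (Branch (2,6) (Branch
   (10,11) (Branch (11,15) (Branch (5,7) (Branch (4,6) (Pivot (6,7)) (Pivot (1,5))) (Pivot (4,6)))
   (Pivot (2,3))) (Pivot (2,3))) (Branch (10,11) (Branch (13,15) (Branch (12,13) (Branch (1,5)
   (Branch (4,5) (Pivot (5,7)) (Branch (3,11) (Pivot (11,15)) (Branch (10,14) (Pivot (12,14)) Crit)))
   (Branch (3,11) (Pivot (11,15)) (Branch (10,14) (Pivot (12,14)) Crit))) (Pivot (10,14))) (Pivot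
   (3,11))) (Branch (13,15) (Branch (1,5) (Branch (4,5) (Pivot (5,7)) (Branch (12,13) (Pivot (12,14))
   Crit)) (Branch (12,13) (Pivot (12,14)) Crit)) (Pivot (12,14))))) (Pivot (12,13)))) (Branch (6,7)
   (Branch (4,5) (Pivot (5,7)) (Pivot (2,6))) (Pivot (4,5)))) (Branch (1,3) (Branch (8,9) (Branch
   (8,10) (Branch (12,13) (Branch (10,14) (Branch (1,5) (Branch (2,6) (Branch (10,11) (Branch (1,9)
   (Pivot (9,13)) (Branch (2,3) (Pivot (3,11)) (Branch (4,5) (Pivot (4,6)) (Branch (8,12) (Pivot
   (12,14)) Crit)))) (Pivot (2,3))) (Pivot (4,5))) (Pivot (9,13))) (Pivot (8,12))) (Branch (4,5)
   (Branch (2,3) (Branch (10,14) (Branch (1,5) (Pivot (1,9)) (Branch (2,6) (Pivot (4,6)) (Branch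
   (3,11) (Pivot (10,11)) Crit))) (Pivot (3,11))) (Pivot (4,6))) (Pivot (1,9)))) (Branch (2,6)
   (Branch (1,5) (Branch (12,13) (Pivot (12,14)) (Pivot (1,9))) (Pivot (4,6))) (Pivot (3,11))))
   (Branch (4,6) (Branch (3,11) (Branch (12,14) (Pivot (12,13)) (Pivot (10,11))) (Pivot (2,6)))
   (Pivot (1,5)))) (Branch (4,5) (Branch (8,12) (Branch (8,10) (Branch (12,13) (Branch (12,14)
   (Branch (2,6) (Pivot (4,6)) (Branch (8,9) (Pivot (9,13)) (Branch (10,11) (Pivot (10,14)) Crit)))
   (Pivot (10,11))) (Pivot (8,9))) (Branch (12,14) (Branch (2,6) (Pivot (4,6)) (Branch (9,13) (Pivot
   (12,13)) Crit)) (Pivot (9,13)))) (Pivot (9,13))) (Pivot (2,6))))) (Branch (7,15) (Branch (1,3)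
   (Branch (10,11) (Branch (1,9) (Branch (6,7) (Branch (3,11) (Branch (13,15) (Branch (8,10) (Branch
   (11,15) (Branch (1,5) (Pivot (5,7)) (Branch (2,3) (Pivot (2,6)) (Branch (8,9) (Pivot (9,13))
   (Branch (10,14) (Pivot (14,15)) Crit)))) (Pivot (10,14))) (Pivot (9,13))) (Branch (10,14) (Branch
   (1,5) (Pivot (5,7)) (Branch (2,3) (Pivot (2,6)) (Branch (8,9) (Pivot (8,10)) Crit))) (Pivot
   (8,9)))) (Pivot (2,6))) (Pivot (1,5))) (Branch (14,15) (Branch (2,6) (Branch (11,15) (Pivot
   (13,15)) (Pivot (2,3))) (Pivot (5,7))) (Pivot (8,10)))) (Branch (6,7) (Branch (1,9) (Branch
   (13,15) (Pivot (14,15)) (Pivot (8,9))) (Pivot (5,7))) (Pivot (2,3)))) (Branch (5,7) (Branch (8,10)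
   (Branch (13,15) (Branch (14,15) (Branch (11,15) (Branch (2,6) (Pivot (6,7)) (Branch (8,9) (Pivot
   (9,13)) (Branch (10,11) (Pivot (10,14)) Crit))) (Pivot (10,14))) (Pivot (10,11))) (Pivot (8,9)))
   (Branch (11,15) (Branch (14,15) (Branch (2,6) (Pivot (6,7)) (Branch (9,13) (Pivot (13,15)) Crit))
   (Pivot (9,13))) (Pivot (9,13)))) (Pivot (2,6)))) (Branch (1,3) (Branch (8,9) (Branch (9,13)
   (Branch (3,11) (Branch (8,10) (Branch (1,5) (Pivot (1,9)) (Branch (2,3) (Pivot (2,6)) (Branch
   (10,11) (Pivot (10,14)) Crit))) (Branch (1,5) (Pivot (1,9)) (Branch (2,3) (Pivot (2,6)) Crit)))
   (Pivot (2,6))) (Pivot (1,5))) (Pivot (1,5))) (Pivot (2,6))))) (Branch (4,12) (Branch (5,7) (Branch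
   (13,15) (Branch (1,9) (Branch (12,13) (Branch (8,12) (Branch (7,15) (Branch (4,5) (Branch (3,11)
   (Branch (11,15) (Branch (1,3) (Pivot (1,5)) (Branch (4,6) (Pivot (6,7)) (Branch (8,9) (Pivot
   (9,13)) (Branch (12,14) (Pivot (14,15)) Crit)))) (Pivot (12,14))) (Pivot (1,5))) (Pivot (6,7)))
   (Pivot (12,14))) (Pivot (9,13))) (Pivot (8,9))) (Branch (6,7) (Branch (7,15) (Branch (14,15)
   (Branch (8,12) (Branch (4,5) (Pivot (4,6)) (Branch (3,11) (Pivot (11,15)) (Branch (12,13) (Pivot
   (12,14)) Crit))) (Branch (4,5) (Pivot (4,6)) (Branch (3,11) (Pivot (11,15)) Crit))) (Pivot
   (3,11))) (Pivot (3,11))) (Pivot (4,5)))) (Branch (1,5) (Branch (6,7) (Branch (1,9) (Branch (12,14)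
   (Branch (1,3) (Pivot (3,11)) (Branch (4,5) (Pivot (4,6)) (Branch (8,9) (Pivot (8,12)) Crit)))
   (Pivot (8,9))) (Pivot (3,11))) (Pivot (4,5))) (Pivot (3,11)))) (Pivot (4,6))) (Branch (7,15)
   (Branch (1,5) (Branch (1,9) (Branch (11,15) (Branch (13,15) (Pivot (14,15)) (Pivot (8,9))) (Pivot
   (1,3))) (Branch (13,15) (Branch (14,15) (Branch (3,11) (Pivot (11,15)) (Branch (5,7) (Pivot (6,7))
   Crit)) (Pivot (3,11))) (Pivot (3,11)))) (Pivot (6,7))) (Branch (1,5) (Branch (1,9) (Branch (1,3)
   (Pivot (3,11)) (Branch (8,9) (Pivot (9,13)) Crit)) (Pivot (3,11))) (Pivot (3,11)))))) (Branch
   (1,5) (Branch (8,9) (Branch (3,11) (Branch (12,13) (Branch (2,10) (Branch (1,9) (Branch (7,15)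
   (Branch (4,12) (Branch (10,11) (Branch (11,15) (Branch (1,3) (Pivot (2,3)) (Branch (4,5) (Pivot
   (5,7)) (Branch (8,10) (Pivot (8,12)) (Branch (9,13) (Pivot (13,15)) Crit)))) (Pivot (9,13)))
   (Pivot (8,12))) (Pivot (5,7))) (Pivot (9,13))) (Pivot (2,3))) (Branch (9,13) (Branch (4,5) (Branch
   (11,15) (Branch (13,15) (Branch (1,3) (Pivot (1,9)) (Branch (4,12) (Pivot (8,12)) (Branch (5,7)
   (Pivot (7,15)) Crit))) (Pivot (5,7))) (Pivot (5,7))) (Pivot (8,12))) (Pivot (1,3)))) (Branch (2,3)
   (Branch (7,15) (Branch (2,10) (Branch (11,15) (Branch (1,3) (Pivot (1,9)) (Branch (4,5) (Pivot
   (5,7)) (Branch (8,10) (Pivot (10,11)) Crit))) (Pivot (8,10))) (Pivot (11,15))) (Pivot (4,5)))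
   (Pivot (1,9)))) (Branch (12,13) (Branch (13,15) (Branch (8,12) (Branch (5,7) (Pivot (7,15)) (Pivot
   (4,12))) (Pivot (2,10))) (Pivot (1,9))) (Pivot (1,9)))) (Branch (3,11) (Branch (2,10) (Branch
   (7,15) (Branch (4,12) (Branch (13,15) (Pivot (12,13)) (Pivot (10,11))) (Pivot (5,7))) (Pivot
   (10,11))) (Pivot (1,3))) (Pivot (2,10)))) (Branch (10,11) (Branch (8,12) (Branch (9,13) (Branch
   (13,15) (Branch (2,10) (Branch (11,15) (Pivot (7,15)) (Pivot (2,3))) (Pivot (8,9))) (Pivot
   (4,12))) (Pivot (4,12))) (Branch (3,11) (Branch (7,15) (Branch (11,15) (Branch (2,3) (Pivot
   (2,10)) (Branch (9,13) (Pivot (13,15)) Crit)) (Pivot (9,13))) (Pivot (9,13))) (Pivot (2,10))))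
   (Pivot (2,3))))) (Branch (12,14) (Branch (2,6) (Branch (4,12) (Branch (5,7) (Branch (6,14) (Branch
   (2,10) (Branch (1,5) (Branch (6,7) (Branch (13,15) (Branch (8,10) (Branch (7,15) (Branch (1,3)
   (Pivot (2,3)) (Branch (4,5) (Pivot (4,6)) (Branch (8,12) (Pivot (12,13)) (Branch (10,14) (Pivot
   (14,15)) Crit)))) (Pivot (10,14))) (Pivot (12,13))) (Branch (10,14) (Branch (1,3) (Pivot (2,3))
   (Branch (4,5) (Pivot (4,6)) (Branch (8,10) (Pivot (8,12)) Crit))) (Pivot (8,12)))) (Pivot (4,5)))
   (Pivot (2,3))) (Branch (4,5) (Branch (7,15) (Branch (13,15) (Pivot (14,15)) (Pivot (8,12))) (Pivot
   (4,6))) (Pivot (1,3)))) (Branch (1,3) (Branch (8,10) (Branch (13,15) (Pivot (7,15)) (Pivot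
   (8,12))) (Pivot (2,3))) (Pivot (4,5)))) (Branch (2,10) (Branch (10,14) (Branch (14,15) (Branch
   (12,13) (Pivot (13,15)) (Pivot (8,10))) (Pivot (4,6))) (Pivot (4,6))) (Pivot (1,3)))) (Branch
   (10,14) (Branch (2,3) (Branch (5,7) (Branch (14,15) (Branch (7,15) (Pivot (13,15)) (Pivot (6,14)))
   (Pivot (6,7))) (Pivot (1,3))) (Pivot (8,10))) (Branch (1,5) (Branch (5,7) (Branch (13,15) (Branch
   (1,3) (Pivot (2,3)) (Branch (6,7) (Pivot (7,15)) Crit)) (Pivot (6,7))) (Pivot (13,15))) (Pivot
   (2,3))))) (Branch (4,5) (Branch (5,7) (Branch (8,12) (Branch (13,15) (Branch (14,15) (Pivot
   (7,15)) (Pivot (8,10))) (Pivot (4,12))) (Branch (7,15) (Branch (13,15) (Branch (1,3) (Pivot (1,5))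
   (Branch (10,14) (Pivot (14,15)) Crit)) (Pivot (10,14))) (Pivot (10,14)))) (Pivot (1,3))) (Pivot
   (1,3)))) (Branch (2,3) (Branch (4,5) (Branch (5,7) (Branch (2,6) (Branch (7,15) (Pivot (13,15))
   (Pivot (4,6))) (Pivot (8,10))) (Pivot (1,3))) (Pivot (1,3))) (Pivot (8,10))))) (Branch (6,14)
   (Branch (3,11) (Branch (2,10) (Branch (8,12) (Branch (9,11) (Branch (10,14) (Branch (2,6) (Branch
   (1,9) (Branch (10,11) (Branch (7,15) (Branch (4,12) (Branch (11,15) (Branch (1,3) (Pivot (2,3))
   (Branch (4,6) (Pivot (6,7)) (Branch (8,9) (Pivot (8,10)) (Branch (12,14) (Pivot (14,15)) Crit))))
   (Pivot (12,14))) (Pivot (6,7))) (Branch (12,14) (Branch (1,3) (Pivot (2,3)) (Branch (4,6) (Pivot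
   (4,12)) (Branch (8,9) (Pivot (8,10)) Crit))) (Pivot (4,6)))) (Pivot (8,9))) (Pivot (2,3))) (Branch
   (8,9) (Branch (14,15) (Branch (11,15) (Pivot (7,15)) (Pivot (8,10))) (Pivot (4,12))) (Pivot
   (1,3)))) (Branch (2,6) (Branch (1,9) (Pivot (8,9)) (Pivot (2,3))) (Pivot (4,12)))) (Branch (2,6)
   (Branch (12,14) (Branch (6,7) (Branch (14,15) (Pivot (7,15)) (Pivot (8,10))) (Pivot (4,12)))
   (Pivot (8,10))) (Pivot (1,3)))) (Branch (11,15) (Branch (2,6) (Branch (1,9) (Branch (7,15) (Branch
   (10,14) (Pivot (14,15)) (Pivot (9,11))) (Pivot (4,6))) (Pivot (2,3))) (Branch (9,11) (Branch
   (14,15) (Pivot (7,15)) (Pivot (10,11))) (Pivot (1,3)))) (Pivot (10,14)))) (Branch (8,9) (Branch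
   (9,11) (Branch (4,12) (Branch (7,15) (Branch (14,15) (Pivot (11,15)) (Pivot (8,12))) (Pivot
   (4,6))) (Branch (11,15) (Branch (14,15) (Branch (1,3) (Pivot (1,9)) (Branch (6,7) (Pivot (7,15))
   Crit)) (Pivot (6,7))) (Pivot (6,7)))) (Pivot (1,3))) (Pivot (1,3)))) (Branch (8,10) (Branch (8,12)
   (Branch (2,6) (Branch (12,14) (Branch (14,15) (Branch (6,7) (Pivot (7,15)) (Pivot (4,12))) (Pivot
   (2,10))) (Pivot (2,10))) (Branch (10,14) (Branch (14,15) (Pivot (7,15)) (Pivot (4,12))) (Pivot
   (4,12)))) (Pivot (1,9))) (Pivot (1,9)))) (Branch (8,9) (Branch (3,11) (Branch (8,10) (Branch
   (9,11) (Branch (2,3) (Branch (11,15) (Pivot (7,15)) (Pivot (2,10))) (Pivot (1,9))) (Pivot (7,15)))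
   (Pivot (4,12))) (Pivot (1,9))) (Pivot (4,12))))) (Branch (9,13) (Branch (10,14) (Split (5,13)
   (6,14) (Branch (4,12) (Branch (5,13) (Branch (8,10) (Branch (9,11) (Branch (6,14) (Branch (8,12)
   (Branch (1,5) (Branch (2,6) (Branch (11,15) (Branch (14,15) (Branch (13,15) (Branch (1,9) (Pivot
   (8,9)) (Branch (2,10) (Pivot (10,11)) (Branch (4,5) (Pivot (4,6)) (Branch (12,13) (Pivot (12,14))
   Crit)))) (Pivot (12,14))) (Pivot (12,13))) (Pivot (2,10))) (Pivot (4,5))) (Pivot (8,9))) (Branch
   (4,5) (Branch (2,10) (Branch (13,15) (Branch (14,15) (Branch (1,5) (Pivot (1,9)) (Branch (2,6)
   (Pivot (4,6)) (Branch (10,11) (Pivot (11,15)) Crit))) (Pivot (10,11))) (Pivot (10,11))) (Pivot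
   (4,6))) (Pivot (1,9)))) (Branch (11,15) (Branch (1,9) (Branch (12,13) (Pivot (13,15)) (Pivot
   (8,9))) (Pivot (4,5))) (Pivot (2,10)))) (Branch (4,6) (Branch (6,14) (Branch (12,14) (Branch
   (13,15) (Pivot (14,15)) (Pivot (8,12))) (Pivot (13,15))) (Pivot (2,10))) (Pivot (1,5)))) (Branch
   (14,15) (Branch (4,6) (Branch (12,14) (Branch (1,9) (Branch (13,15) (Pivot (12,13)) (Pivot
   (9,11))) (Pivot (4,5))) (Pivot (2,6))) (Branch (9,11) (Branch (13,15) (Pivot (11,15)) (Pivot
   (12,14))) (Pivot (1,5)))) (Pivot (12,13)))) (Branch (2,10) (Branch (8,9) (Branch (10,11) (Branch
   (11,15) (Branch (12,14) (Pivot (14,15)) (Pivot (8,10))) (Pivot (1,9))) (Pivot (1,9))) (Branch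
   (14,15) (Pivot (12,14)) (Pivot (10,11)))) (Pivot (4,6)))) (Branch (9,11) (Branch (2,10) (Branch
   (5,13) (Branch (8,9) (Branch (14,15) (Branch (11,15) (Pivot (13,15)) (Pivot (8,10))) (Pivot
   (2,6))) (Pivot (1,5))) (Pivot (2,6))) (Branch (1,5) (Branch (14,15) (Branch (13,15) (Pivot
   (11,15)) (Pivot (6,14))) (Pivot (5,13))) (Pivot (8,9)))) (Branch (6,14) (Branch (13,15) (Pivot
   (14,15)) (Pivot (1,5))) (Pivot (1,5))))) (Branch (8,9) (Branch (10,11) (Branch (11,15) (Branch
   (8,12) (Pivot (4,12)) (Pivot (2,10))) (Pivot (1,9))) (Pivot (1,9))) (Pivot (4,12)))) (Branch (4,5)
   (Branch (4,12) (Branch (1,9) (Branch (12,13) (Branch (13,15) (Branch (9,11) (Pivot (11,15)) (Pivot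
   (8,12))) (Pivot (1,5))) (Pivot (1,5))) (Branch (5,13) (Branch (13,15) (Pivot (11,15)) (Pivot
   (8,12))) (Pivot (8,12)))) (Pivot (2,6))) (Pivot (2,6)))) (Branch (4,6) (Branch (4,12) (Branch
   (10,14) (Branch (2,10) (Branch (12,14) (Branch (14,15) (Branch (10,11) (Pivot (11,15)) (Pivot
   (8,12))) (Pivot (2,6))) (Pivot (2,6))) (Branch (6,14) (Branch (14,15) (Pivot (11,15)) (Pivot
   (8,12))) (Pivot (8,12)))) (Pivot (2,6))) (Pivot (1,5))) (Pivot (1,5)))))"

lemma hasse_codes_15: "hasse_codes 15 =
   [(1,3), (1,5), (1,9), (2,3), (2,6), (2,10), (3,7), (3,11), (4,5), (4,6), (4,12), (5,7), (5,13),
   (6,7), (6,14), (8,9), (8,10), (8,12), (9,11), (9,13), (10,11), (10,14), (12,13), (12,14)]"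
  by code_simp

lemma hasse_codes_16: "hasse_codes 16 =
   [(1,3), (1,5), (1,9), (2,3), (2,6), (2,10), (3,7), (3,11), (4,5), (4,6), (4,12), (5,7), (5,13),
   (6,7), (6,14), (7,15), (8,9), (8,10), (8,12), (9,11), (9,13), (10,11), (10,14), (11,15), (12,13),
   (12,14), (13,15), (14,15)]"
  by code_simp

text \<open>The argument 5 is the number of vertices of a 4-dimensional cell, here a matching of
  five Hasse edges.\<close>

lemma valid_tree_15: "valid_tree tree15 share_node 5 (hasse_codes 15)"
  unfolding hasse_codes_15 by code_simp

lemma critical_count_15: "critical_count tree15 = 39"
  by code_simp

lemma valid_tree_16: "valid_tree tree16 share_node 5 (hasse_codes 16)"
  unfolding hasse_codes_16 by code_simp

lemma critical_count_16: "critical_count tree16 = 39"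
  by code_simp

theorem mainTheorem14:
  shows "geometric_realization (GM simplex3) homotopy_equivalent_space
           geometric_realization (GM boundary_simplex3)
       \<and> geometric_realization (GM boundary_simplex3) homotopy_equivalent_space
           wedge_of_spheres 39 4"
proof -
  have "geometric_realization (GM simplex3) homotopy_equivalent_space wedge_of_spheres 39 4"
    unfolding simplex3_bits
    by (rule GM_wedge_of_spheres[where t = tree16])
      (use valid_tree_16 critical_count_16 in \<open>simp_all add: hasse_codes_16\<close>)
  moreover have "geometric_realization (GM boundary_simplex3) homotopy_equivalent_space wedge_of_spheres 39 4"
    unfolding boundary_simplex3_bits
    by (rule GM_wedge_of_spheres[where t = tree15])
      (use valid_tree_15 critical_count_15 in \<open>simp_all add: hasse_codes_15\<close>)
  \<comment> \<open>The two complexes are related only through the common wedge, by symmetry and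
    transitivity.\<close>
  ultimately show ?thesis
    using homotopy_eqv_trans homotopy_equivalent_space_sym by blast
qed

end
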